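(* Let $\phi:(M^2,g=\rho^2\,dz\,d\bar z)\to(N^2,h=\sigma^2\,dw\,d\bar w)$, $w=\phi(z)$, be a map between two surfaces with conformal metrics, where $z=x+iy$ and $w=u+iv$ are complex coordinates from isothermal coordinates $(x,y)$ on $M$ and $(u,v)$ on $N$. Then the bitension field of $\phi$, in complex notation, is $$\tau^2(\phi)=4\rho^{-2}\Big\{\tau_{z\bar z}+2(\ln\sigma)_w\Big[\tau_z\phi_{\bar z}+\tau_{\bar z}\phi_z+\tfrac14\rho^2(\tau)^2\Big]+2\bar\tau\,(\ln\sigma)_{w\bar w}\,\phi_z\phi_{\bar z}+2\tau\,\phi_z\phi_{\bar z}\,(\ln\sigma)_{ww}\Big\},$$ where $\tau=\tau(\phi)=4\rho^{-2}\big[\phi_{z\bar z}+2(\ln\sigma)_w\,\phi_z\phi_{\bar z}\big]$ is the tension field of $\phi$ in complex notation.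
   Context: All manifolds, maps and tensor fields are smooth. For a map $\phi:(M,g)\to(N,h)$ between Riemannian manifolds the tension field is $\tau(\phi)=\mathrm{Trace}_g\nabla d\phi$, and the bitension field is $$\tau^2(\phi)=\mathrm{Trace}_g\big(\nabla^\phi\nabla^\phi-\nabla^\phi_{\nabla^M}\big)\tau(\phi)-\mathrm{Trace}_g R^N(d\phi,\tau(\phi))\,d\phi,$$ with $R^N(X,Y)Z=[\nabla^N_X,\nabla^N_Y]Z-\nabla^N_{[X,Y]}Z$. Complex notation: $\rho>0$ and $\sigma>0$ are functions of $(x,y)$ and $(u,v)$ respectively, $\rho^2dzd\bar z=\rho^2(dx^2+dy^2)$, $\sigma^2dwd\bar w=\sigma^2(du^2+dv^2)$; $\frac{\partial}{\partial z}=\frac12(\frac{\partial}{\partial x}-i\frac{\partial}{\partial y})$, $\frac{\partial}{\partial\bar z}=\frac12(\frac{\partial}{\partial x}+i\frac{\partial}{\partial y})$, and similarly for $w$. Subscripts denote these derivatives. The map is written $\phi=\phi^1+i\phi^2$, and a vector field $V=V^1\frac{\partial}{\partial u}+V^2\frac{\partial}{\partial v}$ along $\phi$ is identified with the complex function $V^1+iV^2$; this applies to $\tau(\phi)$ and $\tau^2(\phi)$. The quantities $(\ln\sigma)_w$, $(\ln\sigma)_{ww}$, $(\ln\sigma)_{w\bar w}$ are evaluated at $w=\phi(z)$. *)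

theory Defs
  imports "HOL-Analysis.Analysis"
begin

section \<open>Smooth maps between open subsets of Euclidean spaces\<close>

text \<open>\<open>k_times_differentiable k f S\<close> is meant for open \<open>S\<close>; the derivatives are two-sided.\<close>

primrec k_times_differentiable ::
    "nat \<Rightarrow> ('a::euclidean_space \<Rightarrow> 'b::real_normed_vector) \<Rightarrow> 'a set \<Rightarrow> bool" where
  "k_times_differentiable 0 f S \<longleftrightarrow> continuous_on S f"
| "k_times_differentiable (Suc k) f S \<longleftrightarrow>
     (\<forall>x\<in>S. f differentiable (at x)) \<and>
     (\<forall>v. k_times_differentiable k (\<lambda>x. frechet_derivative f (at x) v) S)"

definition smooth_on :: "'a set \<Rightarrow> ('a::euclidean_space \<Rightarrow> 'b::real_normed_vector) \<Rightarrow> bool" where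
  "smooth_on S f \<longleftrightarrow> (\<forall>k. k_times_differentiable k f S)"


section \<open>Riemannian geometry in a coordinate domain\<close>

text \<open>A metric on a coordinate domain is given by its matrix of components, and a vector field
  by its vector of components with respect to the coordinate frame. All constants below are
  meaningful at interior points of the domain on which the data are smooth.\<close>

definition pd :: "'n \<Rightarrow> (real^'n \<Rightarrow> 'b::real_normed_vector) \<Rightarrow> real^'n \<Rightarrow> 'b" where
  "pd i f p = frechet_derivative f (at p) (axis i 1)"

text \<open>\<open>christoffel g k i j\<close> is $\Gamma^k_{ij}$.\<close>

definition christoffel ::
    "(real^'n \<Rightarrow> real^'n^'n) \<Rightarrow> 'n \<Rightarrow> 'n \<Rightarrow> 'n \<Rightarrow> real^'n \<Rightarrow> real" where
  "christoffel g k i j p =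
     (\<Sum>l\<in>UNIV. matrix_inv (g p) $ k $ l *
        (pd i (\<lambda>q. g q $ j $ l) p + pd j (\<lambda>q. g q $ i $ l) p - pd l (\<lambda>q. g q $ i $ j) p)) / 2"

definition christoffel_form ::
    "(real^'n \<Rightarrow> real^'n^'n) \<Rightarrow> real^'n \<Rightarrow> real^'n \<Rightarrow> real^'n \<Rightarrow> real^'n" where
  "christoffel_form g p a b = (\<chi> k. \<Sum>i\<in>UNIV. \<Sum>j\<in>UNIV. christoffel g k i j p * a $ i * b $ j)"

definition levi_civita ::
    "(real^'n \<Rightarrow> real^'n^'n) \<Rightarrow> (real^'n \<Rightarrow> real^'n) \<Rightarrow> (real^'n \<Rightarrow> real^'n) \<Rightarrow> real^'n \<Rightarrow> real^'n" where
  "levi_civita g X Y p = frechet_derivative Y (at p) (X p) + christoffel_form g p (X p) (Y p)"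

definition lie_bracket ::
    "(real^'n \<Rightarrow> real^'n) \<Rightarrow> (real^'n \<Rightarrow> real^'n) \<Rightarrow> real^'n \<Rightarrow> real^'n" where
  "lie_bracket X Y p = frechet_derivative Y (at p) (X p) - frechet_derivative X (at p) (Y p)"

definition curvature_field ::
    "(real^'n \<Rightarrow> real^'n^'n) \<Rightarrow> (real^'n \<Rightarrow> real^'n) \<Rightarrow> (real^'n \<Rightarrow> real^'n) \<Rightarrow> (real^'n \<Rightarrow> real^'n)
      \<Rightarrow> real^'n \<Rightarrow> real^'n" where
  "curvature_field g X Y Z p =
     levi_civita g X (levi_civita g Y Z) p - levi_civita g Y (levi_civita g X Z) p
     - levi_civita g (lie_bracket X Y) Z p"

text \<open>The curvature tensor on tangent vectors \<open>a, b, c\<close> at \<open>p\<close>, evaluated, by tensoriality, on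
  the extensions of these vectors with constant components.\<close>

definition curvature ::
    "(real^'n \<Rightarrow> real^'n^'n) \<Rightarrow> real^'n \<Rightarrow> real^'n \<Rightarrow> real^'n \<Rightarrow> real^'n \<Rightarrow> real^'n" where
  "curvature g p a b c = curvature_field g (\<lambda>_. a) (\<lambda>_. b) (\<lambda>_. c) p"

definition coord_field :: "'n \<Rightarrow> real^'n \<Rightarrow> real^'n" where
  "coord_field i = (\<lambda>_. axis i 1)"

definition differential ::
    "(real^'m \<Rightarrow> real^'n) \<Rightarrow> (real^'m \<Rightarrow> real^'m) \<Rightarrow> real^'m \<Rightarrow> real^'n" where
  "differential f X p = frechet_derivative f (at p) (X p)"

text \<open>The connection induced by \<open>h\<close> on the pullback bundle of a map \<open>f\<close>; \<open>X\<close> is a vector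
  field on the source and \<open>V\<close> a vector field along \<open>f\<close>.\<close>

definition pullback_connection ::
    "(real^'n \<Rightarrow> real^'n^'n) \<Rightarrow> (real^'m \<Rightarrow> real^'n) \<Rightarrow> (real^'m \<Rightarrow> real^'m) \<Rightarrow> (real^'m \<Rightarrow> real^'n)
      \<Rightarrow> real^'m \<Rightarrow> real^'n" where
  "pullback_connection h f X V p =
     frechet_derivative V (at p) (X p) + christoffel_form h (f p) (differential f X p) (V p)"

definition second_fundamental_form ::
    "(real^'m \<Rightarrow> real^'m^'m) \<Rightarrow> (real^'n \<Rightarrow> real^'n^'n) \<Rightarrow> (real^'m \<Rightarrow> real^'n)
      \<Rightarrow> (real^'m \<Rightarrow> real^'m) \<Rightarrow> (real^'m \<Rightarrow> real^'m) \<Rightarrow> real^'m \<Rightarrow> real^'n" where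
  "second_fundamental_form g h f X Y p =
     pullback_connection h f X (differential f Y) p - differential f (levi_civita g X Y) p"

text \<open>The trace of a bilinear form on the tangent space at \<open>p\<close>, given by its values on pairs
  of coordinate vectors.\<close>

definition metric_trace ::
    "(real^'m \<Rightarrow> real^'m^'m) \<Rightarrow> real^'m \<Rightarrow> ('m \<Rightarrow> 'm \<Rightarrow> real^'n) \<Rightarrow> real^'n" where
  "metric_trace g p b = (\<Sum>i\<in>UNIV. \<Sum>j\<in>UNIV. (matrix_inv (g p) $ i $ j) *\<^sub>R b i j)"

definition tension ::
    "(real^'m \<Rightarrow> real^'m^'m) \<Rightarrow> (real^'n \<Rightarrow> real^'n^'n) \<Rightarrow> (real^'m \<Rightarrow> real^'n)
      \<Rightarrow> real^'m \<Rightarrow> real^'n" where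
  "tension g h f p =
     metric_trace g p (\<lambda>i j. second_fundamental_form g h f (coord_field i) (coord_field j) p)"

definition bitension ::
    "(real^'m \<Rightarrow> real^'m^'m) \<Rightarrow> (real^'n \<Rightarrow> real^'n^'n) \<Rightarrow> (real^'m \<Rightarrow> real^'n)
      \<Rightarrow> real^'m \<Rightarrow> real^'n" where
  "bitension g h f p =
     metric_trace g p (\<lambda>i j.
       pullback_connection h f (coord_field i)
         (pullback_connection h f (coord_field j) (tension g h f)) p
       - pullback_connection h f (levi_civita g (coord_field i) (coord_field j)) (tension g h f) p)
     - metric_trace g p (\<lambda>i j.
         curvature h (f p) (differential f (coord_field i) p) (tension g h f p)
           (differential f (coord_field j) p))"

text \<open>The Christoffel symbols are those of the torsion free and metric connection.\<close>

lemma christoffel_symmetric: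
  assumes "\<And>q. transpose (g q) = g q"
  shows "christoffel g k i j p = christoffel g k j i p"
proof -
  have "g q $ i $ j = g q $ j $ i" for q
    using assms[of q] by (metis transpose_def vec_lambda_beta)
  then show ?thesis
    by (simp add: christoffel_def add.commute)
qed

lemma christoffel_metric:
  fixes g :: "real^'n \<Rightarrow> real^'n^'n"
  assumes sym: "\<And>q. transpose (g q) = g q" and inv: "invertible (g p)"
  shows "pd k (\<lambda>q. g q $ i $ j) p =
    (\<Sum>l\<in>UNIV. christoffel g l k i p * g p $ l $ j + christoffel g l k j p * g p $ i $ l)"
proof -
  have s: "g q $ a $ b = g q $ b $ a" for q a b
    using sym[of q] by (metis transpose_def vec_lambda_beta)
  define L where "L = (\<lambda>a b l. pd a (\<lambda>q. g q $ b $ l) p + pd b (\<lambda>q. g q $ a $ l) p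
    - pd l (\<lambda>q. g q $ a $ b) p)"
  have gi: "g p ** matrix_inv (g p) = mat 1"
    using inv unfolding invertible_def matrix_inv_def by (rule someI2_ex) simp
  have lower: "(\<Sum>l\<in>UNIV. christoffel g l a b p * g p $ c $ l) = L a b c / 2" for a b c
  proof -
    have "(\<Sum>l\<in>UNIV. christoffel g l a b p * g p $ c $ l) =
        (\<Sum>l\<in>UNIV. \<Sum>m\<in>UNIV. g p $ c $ l * matrix_inv (g p) $ l $ m * L a b m / 2)"
      by (simp add: christoffel_def L_def sum_distrib_left sum_distrib_right sum_divide_distrib
          mult_ac)
    also have "\<dots> = (\<Sum>m\<in>UNIV. (\<Sum>l\<in>UNIV. g p $ c $ l * matrix_inv (g p) $ l $ m) * (L a b m / 2))"
      by (subst sum.swap) (simp add: sum_distrib_right sum_divide_distrib)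
    also have "\<dots> = (\<Sum>m\<in>UNIV. (g p ** matrix_inv (g p)) $ c $ m * (L a b m / 2))"
      by (simp add: matrix_matrix_mult_def)
    also have "\<dots> = L a b c / 2"
      by (simp add: gi mat_def sum_divide_distrib[symmetric] if_distrib[of "\<lambda>x. x * _"] cong: if_cong)
    finally show ?thesis .
  qed
  have "(\<Sum>l\<in>UNIV. christoffel g l k i p * g p $ l $ j + christoffel g l k j p * g p $ i $ l) =
      (\<Sum>l\<in>UNIV. christoffel g l k i p * g p $ j $ l) + (\<Sum>l\<in>UNIV. christoffel g l k j p * g p $ i $ l)"
    by (simp add: sum.distrib s[of p _ j])
  also have "\<dots> = L k i j / 2 + L k j i / 2"
    by (simp only: lower)
  also have "\<dots> = pd k (\<lambda>q. g q $ i $ j) p"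
    using s[of _ i j] by (simp add: L_def add_divide_distrib[symmetric] s[of _ j k] s[of _ i k])
  finally show ?thesis by simp
qed


section \<open>Riemannian manifolds\<close>

text \<open>A chart is a pair of a domain and a coordinate map, of which only the values on the domain
  matter. A manifold is given by an atlas, and its underlying set is the union of the domains
  of the charts. A Riemannian metric is given by its component matrix in each chart of the atlas.\<close>

type_synonym ('a, 'n) chart = "'a set \<times> ('a \<Rightarrow> real^'n)"

abbreviation chart_inv :: "('a, 'n::finite) chart \<Rightarrow> real^'n \<Rightarrow> 'a" where
  "chart_inv c \<equiv> inv_into (fst c) (snd c)"

definition carrier_of :: "('a, 'n::finite) chart set \<Rightarrow> 'a set" where
  "carrier_of A = (\<Union>c\<in>A. fst c)"

definition smooth_atlas ::
    "('a::{t2_space, second_countable_topology}, 'n::finite) chart set \<Rightarrow> bool" where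
  "smooth_atlas A \<longleftrightarrow>
     (\<forall>c\<in>A. open (fst c) \<and> open (snd c ` fst c) \<and>
        homeomorphism (fst c) (snd c ` fst c) (snd c) (chart_inv c)) \<and>
     (\<forall>c\<in>A. \<forall>d\<in>A. smooth_on (snd c ` (fst c \<inter> fst d)) (snd d \<circ> chart_inv c))"

definition riemannian_manifold ::
    "('a::{t2_space, second_countable_topology}, 'n::finite) chart set
      \<Rightarrow> (('a, 'n) chart \<Rightarrow> real^'n \<Rightarrow> real^'n^'n) \<Rightarrow> bool" where
  "riemannian_manifold A g \<longleftrightarrow>
     smooth_atlas A \<and>
     (\<forall>c\<in>A. smooth_on (snd c ` fst c) (g c) \<and>
        (\<forall>p\<in>snd c ` fst c. transpose (g c p) = g c p \<and> (\<forall>v. v \<noteq> 0 \<longrightarrow> v \<bullet> (g c p *v v) > 0))) \<and>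
     (\<forall>c\<in>A. \<forall>d\<in>A. \<forall>x\<in>fst c \<inter> fst d.
        let J = matrix (frechet_derivative (snd d \<circ> chart_inv c) (at (snd c x)))
        in g c (snd c x) = transpose J ** g d (snd d x) ** J)"

definition local_rep ::
    "('a, 'm::finite) chart \<Rightarrow> ('b, 'n::finite) chart \<Rightarrow> ('a \<Rightarrow> 'b) \<Rightarrow> real^'m \<Rightarrow> real^'n" where
  "local_rep c d \<phi> = snd d \<circ> \<phi> \<circ> chart_inv c"

definition smooth_map ::
    "('a::topological_space, 'm::finite) chart set \<Rightarrow> ('b::topological_space, 'n::finite) chart set
      \<Rightarrow> ('a \<Rightarrow> 'b) \<Rightarrow> bool" where
  "smooth_map A B \<phi> \<longleftrightarrow>
     \<phi> ` carrier_of A \<subseteq> carrier_of B \<and> continuous_on (carrier_of A) \<phi> \<and>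
     (\<forall>c\<in>A. \<forall>d\<in>B. smooth_on (snd c ` (fst c \<inter> \<phi> -` fst d)) (local_rep c d \<phi>))"

text \<open>The components of the tension and bitension fields in the coordinates given by a chart
  \<open>c\<close> of the source and a chart \<open>d\<close> of the target, as functions of the coordinates of \<open>c\<close>.\<close>

definition tension_field ::
    "(('a, 'm::finite) chart \<Rightarrow> real^'m \<Rightarrow> real^'m^'m) \<Rightarrow> (('b, 'n::finite) chart \<Rightarrow> real^'n \<Rightarrow> real^'n^'n)
      \<Rightarrow> ('a \<Rightarrow> 'b) \<Rightarrow> ('a, 'm) chart \<Rightarrow> ('b, 'n) chart \<Rightarrow> real^'m \<Rightarrow> real^'n" where
  "tension_field g h \<phi> c d = tension (g c) (h d) (local_rep c d \<phi>)"

definition bitension_field ::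
    "(('a, 'm::finite) chart \<Rightarrow> real^'m \<Rightarrow> real^'m^'m) \<Rightarrow> (('b, 'n::finite) chart \<Rightarrow> real^'n \<Rightarrow> real^'n^'n)
      \<Rightarrow> ('a \<Rightarrow> 'b) \<Rightarrow> ('a, 'm) chart \<Rightarrow> ('b, 'n) chart \<Rightarrow> real^'m \<Rightarrow> real^'n" where
  "bitension_field g h \<phi> c d = bitension (g c) (h d) (local_rep c d \<phi>)"


section \<open>Complex notation on surfaces\<close>

definition to_complex :: "real^2 \<Rightarrow> complex" where
  "to_complex p = Complex (p $ 1) (p $ 2)"

definition of_complex :: "complex \<Rightarrow> real^2" where
  "of_complex z = vector [Re z, Im z]"

definition complex_notation :: "(real^2 \<Rightarrow> real^2) \<Rightarrow> complex \<Rightarrow> complex" where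
  "complex_notation V = to_complex \<circ> V \<circ> of_complex"

definition d_z :: "(complex \<Rightarrow> complex) \<Rightarrow> complex \<Rightarrow> complex" where
  "d_z f z = (frechet_derivative f (at z) 1 - \<i> * frechet_derivative f (at z) \<i>) / 2"

definition d_zbar :: "(complex \<Rightarrow> complex) \<Rightarrow> complex \<Rightarrow> complex" where
  "d_zbar f z = (frechet_derivative f (at z) 1 + \<i> * frechet_derivative f (at z) \<i>) / 2"

text \<open>The metric is $\rho^2 dz d\bar z = \rho^2(dx^2+dy^2)$ in the coordinates of the chart \<open>c\<close>.\<close>

definition isothermal ::
    "(('a, 2) chart \<Rightarrow> real^2 \<Rightarrow> real^2^2) \<Rightarrow> ('a, 2) chart \<Rightarrow> (complex \<Rightarrow> real) \<Rightarrow> bool" where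
  "isothermal g c \<rho> \<longleftrightarrow>
     smooth_on (to_complex ` snd c ` fst c) \<rho> \<and>
     (\<forall>p\<in>snd c ` fst c. \<rho> (to_complex p) > 0 \<and> g c p = mat ((\<rho> (to_complex p))\<^sup>2))"

end

theory Submission
  imports Defs
begin

text \<open>
  Let $\Gamma = 2 (\ln\sigma)_w$. In complex notation the Christoffel form of the conformal metric
  $\sigma^2 dw d\bar w$ is the complex product \<open>\<Gamma> a b\<close> (\<open>christoffel_form_complex\<close>). The connection
  induced along \<open>\<phi>\<close> therefore differentiates \<open>V\<close> in the direction \<open>a\<close> to
  $D_a V + \Gamma(\phi) (D_a\phi) V$, and the curvature tensor is
  $R(a,b)c = \Gamma_{\bar w} (\bar a b - a \bar b) c$ (\<open>curvature_complex\<close>).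

  The trace over the domain is $\rho^{-2}$ times the sum over the directions \<open>1\<close> and \<open>\<i>\<close>. The
  Christoffel form of the domain is also a complex product, so it is annihilated by this sum
  because \<open>1 + \<i>\<^sup>2 = 0\<close> (\<open>levi_civita_coord_trace\<close>). The identities
  $\phi_x^2 + \phi_y^2 = 4\phi_z\phi_{\bar z}$ and $\phi_{xx} + \phi_{yy} = 4\phi_{z\bar z}$ then
  give the tension field (\<open>tension_complex\<close>).

  Applying the induced connection twice to \<open>\<tau>\<close>, summing, and recognizing \<open>\<rho>\<^sup>2 \<tau>\<close> among the terms
  gives the rough Laplacian. Its part $\Gamma_{\bar w} \tau (|\phi_x|^2 + |\phi_y|^2)$ is cancelled
  by the curvature term, which leaves $4 \Gamma_{\bar w} \bar\tau \phi_z\phi_{\bar z}$ in its place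
  (\<open>bitension_complex\<close>).

  Frechet derivatives are given by choice and carry no information where a function is not
  differentiable. Every differentiation above thus needs the smoothness of its argument, in
  particular of the tension field; this is supplied by closure properties of smooth functions.
  The identity for $\phi_{z\bar z}$ moreover requires the symmetry of second derivatives.\<close>

section \<open>Closure properties of differentiability and smoothness\<close>

text \<open>The point is the last argument, so that a derivative along a fixed vector is again a field
  and derivatives can be iterated.\<close>

abbreviation dir_deriv :: "('a::real_normed_vector \<Rightarrow> 'b::real_normed_vector) \<Rightarrow> 'a \<Rightarrow> 'a \<Rightarrow> 'b" where
  "dir_deriv f v \<equiv> \<lambda>x. frechet_derivative f (at x) v"

lemma frechet_derivative_eqI: "(f has_derivative f') (at x) \<Longrightarrow> frechet_derivative f (at x) v = f' v"
  using frechet_derivative_at by metis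

lemma differentiable_transform_open:
  assumes "f differentiable (at x)" "open S" "x \<in> S" "\<And>y. y \<in> S \<Longrightarrow> f y = g y"
  shows "g differentiable (at x)"
  using assms has_derivative_transform_within_open[of f _ x UNIV S g]
  unfolding differentiable_def by fastforce

lemma frechet_derivative_transform_open:
  assumes "f differentiable (at x)" "open S" "x \<in> S" "\<And>y. y \<in> S \<Longrightarrow> f y = g y"
  shows "frechet_derivative f (at x) = frechet_derivative g (at x)"
  using frechet_derivative_transform_within_open[of f x S g] assms by blast

lemma k_times_differentiable_cong:
  assumes "open S" "\<And>x. x \<in> S \<Longrightarrow> f x = g x" "k_times_differentiable k f S"
  shows "k_times_differentiable k g S"
  using assms(2,3)
proof (induction k arbitrary: f g)
  case 0
  then show ?case by (simp cong: continuous_on_cong)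
next
  case (Suc k)
  have d: "f differentiable (at x)" if "x \<in> S" for x using Suc.prems that by simp
  have "k_times_differentiable k (\<lambda>x. frechet_derivative g (at x) v) S" for v
    by (rule Suc.IH[of "\<lambda>x. frechet_derivative f (at x) v"])
      (use Suc.prems frechet_derivative_transform_open[OF d \<open>open S\<close>] in auto)
  then show ?case
    using differentiable_transform_open[OF d \<open>open S\<close>] Suc.prems(1) by auto
qed

lemma k_times_differentiable_Suc_imp:
  "k_times_differentiable (Suc k) f S \<Longrightarrow> k_times_differentiable k f S"
proof (induction k arbitrary: f)
  case 0
  then show ?case
    by (auto intro!: differentiable_imp_continuous_on differentiable_at_imp_differentiable_on)
next
  case (Suc k)
  then show ?case by (metis k_times_differentiable.simps(2))
qed

lemma k_times_differentiable_const: "k_times_differentiable k (\<lambda>_. c) S"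
  by (induction k arbitrary: c) auto

lemma k_times_differentiable_bounded_linear:
  assumes "bounded_linear f"
  shows "k_times_differentiable k f S"
proof (cases k)
  case 0
  then show ?thesis using assms by (simp add: linear_continuous_on)
next
  case (Suc n)
  have d: "(f has_derivative f) (at x)" for x by (rule bounded_linear_imp_has_derivative[OF assms])
  then show ?thesis
    using Suc by (auto simp: frechet_derivative_eqI[OF d] k_times_differentiable_const differentiable_def)
qed

lemma k_times_differentiable_add:
  assumes "open S" "k_times_differentiable k f S" "k_times_differentiable k g S"
  shows "k_times_differentiable k (\<lambda>x. f x + g x) S"
  using assms(2,3)
proof (induction k arbitrary: f g)
  case 0
  then show ?case by (auto intro: continuous_on_add)
next
  case (Suc k)
  have e: "frechet_derivative f (at x) v + frechet_derivative g (at x) v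
      = frechet_derivative (\<lambda>x. f x + g x) (at x) v" if "x \<in> S" for x v
    using Suc.prems that
    by (intro frechet_derivative_eqI[symmetric] has_derivative_add) (auto simp: frechet_derivative_works)
  have "k_times_differentiable k (\<lambda>x. frechet_derivative (\<lambda>x. f x + g x) (at x) v) S" for v
    by (rule k_times_differentiable_cong[OF \<open>open S\<close> e]) (use Suc in auto)
  then show ?case using Suc.prems by auto
qed

text \<open>By the product rule the derivative is a sum of two terms of the same shape in which one
  factor is a derivative. The undifferentiated factor has one derivative to spare, which is why
  the induction needs that the property is inherited by smaller \<open>k\<close>.\<close>

lemma k_times_differentiable_bilinear:
  assumes b: "bounded_bilinear m" and "open S"
    and "k_times_differentiable k f S" "k_times_differentiable k g S"
  shows "k_times_differentiable k (\<lambda>x. m (f x) (g x)) S"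
  using assms(3,4)
proof (induction k arbitrary: f g)
  case 0
  then show ?case by (auto intro: bounded_bilinear.continuous_on[OF b])
next
  case (Suc k)
  note low = k_times_differentiable_Suc_imp[OF Suc.prems(1)] k_times_differentiable_Suc_imp[OF Suc.prems(2)]
  have h: "((\<lambda>x. m (f x) (g x)) has_derivative
      (\<lambda>v. m (f x) (frechet_derivative g (at x) v) + m (frechet_derivative f (at x) v) (g x))) (at x)"
    if "x \<in> S" for x
    using Suc.prems that
    by (intro bounded_bilinear.FDERIV[OF b]) (auto simp: frechet_derivative_works)
  have "k_times_differentiable k (\<lambda>x. frechet_derivative (\<lambda>x. m (f x) (g x)) (at x) v) S" for v
    by (rule k_times_differentiable_cong[OF \<open>open S\<close> frechet_derivative_eqI[OF h, symmetric]], assumption)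
      (intro k_times_differentiable_add[OF \<open>open S\<close>] Suc.IH low; use Suc.prems in simp)
  then show ?case using h by (auto simp: differentiable_def)
qed

lemma k_times_differentiable_sum:
  assumes "open S" "finite I" "\<And>i. i \<in> I \<Longrightarrow> k_times_differentiable k (f i) S"
  shows "k_times_differentiable k (\<lambda>x. \<Sum>i\<in>I. f i x) S"
  using assms(2,3)
  by (induction rule: finite_induct)
    (auto intro: k_times_differentiable_add assms(1) k_times_differentiable_const)

lemma k_times_differentiable_linear_compose:
  assumes b: "bounded_linear l" and "open S" and "k_times_differentiable k f S"
  shows "k_times_differentiable k (\<lambda>x. l (f x)) S"
  using assms(3)
proof (induction k arbitrary: f)
  case 0
  then show ?case by (auto intro: bounded_linear.continuous_on[OF b])
next
  case (Suc k)
  have h: "((\<lambda>x. l (f x)) has_derivative (\<lambda>v. l (frechet_derivative f (at x) v))) (at x)"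
    if "x \<in> S" for x
    using Suc.prems that
    by (intro bounded_linear.has_derivative[OF b]) (auto simp: frechet_derivative_works)
  have "k_times_differentiable k (\<lambda>x. frechet_derivative (\<lambda>x. l (f x)) (at x) v) S" for v
    by (rule k_times_differentiable_cong[OF \<open>open S\<close> frechet_derivative_eqI[OF h, symmetric]])
      (use Suc in auto)
  then show ?case using h by (auto simp: differentiable_def)
qed

text \<open>Expanding the inner derivative in the standard basis turns the chain rule into a finite sum
  of products of a scalar component of the inner derivative with a partial derivative of \<open>f\<close>
  composed with \<open>g\<close>; the induction hypothesis applies to the latter.\<close>

lemma k_times_differentiable_compose:
  fixes g :: "'a::euclidean_space \<Rightarrow> 'c::euclidean_space" and f :: "'c \<Rightarrow> 'b::real_normed_vector"
  assumes "open S" "open T" "g ` S \<subseteq> T"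
    and "k_times_differentiable k f T" "k_times_differentiable k g S"
  shows "k_times_differentiable k (\<lambda>x. f (g x)) S"
  using assms(4,5)
proof (induction k arbitrary: f)
  case 0
  then show ?case using assms(3) by (auto intro: continuous_on_compose2)
next
  case (Suc k)
  have h: "((\<lambda>x. f (g x)) has_derivative
      (\<lambda>v. frechet_derivative f (at (g x)) (frechet_derivative g (at x) v))) (at x)"
    if "x \<in> S" for x
    by (rule has_derivative_compose[where g=f])
      (use Suc.prems that assms(3) in \<open>auto simp flip: frechet_derivative_works\<close>)
  have e: "frechet_derivative (\<lambda>x. f (g x)) (at x) v =
      (\<Sum>b\<in>Basis. (frechet_derivative g (at x) v \<bullet> b) *\<^sub>R frechet_derivative f (at (g x)) b)"
    if "x \<in> S" for x v
  proof -
    define L where "L = frechet_derivative f (at (g x))"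
    define w where "w = frechet_derivative g (at x) v"
    have "linear L"
      unfolding L_def using Suc.prems(1) that assms(3) by (intro linear_frechet_derivative) auto
    have "L w = L (\<Sum>b\<in>Basis. (w \<bullet> b) *\<^sub>R b)" by (simp only: euclidean_representation)
    also have "\<dots> = (\<Sum>b\<in>Basis. (w \<bullet> b) *\<^sub>R L b)"
      by (simp only: linear_sum[OF \<open>linear L\<close>] linear_cmul[OF \<open>linear L\<close>])
    finally show ?thesis
      unfolding frechet_derivative_eqI[OF h[OF that]] L_def w_def .
  qed
  have "k_times_differentiable k (\<lambda>x. frechet_derivative (\<lambda>x. f (g x)) (at x) v) S" for v
  proof (rule k_times_differentiable_cong[OF \<open>open S\<close> e[symmetric]], assumption,
      intro k_times_differentiable_sum k_times_differentiable_bilinear[OF bounded_bilinear_scaleR])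
    fix b :: 'c
    show "k_times_differentiable k (\<lambda>x. frechet_derivative g (at x) v \<bullet> b) S"
      using Suc.prems
      by (intro k_times_differentiable_linear_compose[OF bounded_linear_inner_left] \<open>open S\<close>) auto
    show "k_times_differentiable k (\<lambda>x. frechet_derivative f (at (g x)) b) S"
      by (rule Suc.IH) (use Suc.prems(1) k_times_differentiable_Suc_imp[OF Suc.prems(2)] in simp_all)
  qed (simp_all add: assms)
  then show ?case using h by (auto simp: differentiable_def)
qed

lemma k_times_differentiable_inverse: "k_times_differentiable k (inverse :: real \<Rightarrow> real) {0<..}"
proof (induction k)
  case 0
  show ?case by (auto intro!: continuous_intros)
next
  case (Suc k)
  have h: "(inverse has_derivative (\<lambda>v. - (inverse x * v * inverse x))) (at x)"
    if "x \<in> {0<..}" for x :: real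
    using that by (intro has_derivative_inverse') auto
  have "k_times_differentiable k (\<lambda>x. frechet_derivative inverse (at x) v) {0<..}" for v :: real
    by (rule k_times_differentiable_cong[OF open_greaterThan frechet_derivative_eqI[OF h, symmetric]])
      (auto intro!: k_times_differentiable_linear_compose[OF bounded_linear_minus[OF bounded_linear_ident]]
        k_times_differentiable_bilinear[OF bounded_bilinear_mult] k_times_differentiable_const Suc)
  then show ?case using h by (auto simp: differentiable_def)
qed

lemma k_times_differentiable_ln: "k_times_differentiable k (ln :: real \<Rightarrow> real) {0<..}"
proof (cases k)
  case 0
  then show ?thesis by (auto intro!: continuous_intros)
next
  case (Suc n)
  have h: "(ln has_derivative (\<lambda>v. v * inverse x)) (at x)" if "x \<in> {0<..}" for x :: real
    using DERIV_ln[of x] that by (simp add: has_field_derivative_def mult_commute_abs)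
  have "k_times_differentiable n (\<lambda>x. frechet_derivative ln (at x) v) {0<..}" for v :: real
    by (rule k_times_differentiable_cong[OF open_greaterThan frechet_derivative_eqI[OF h, symmetric]])
      (auto intro!: k_times_differentiable_bilinear[OF bounded_bilinear_mult]
        k_times_differentiable_const k_times_differentiable_inverse)
  then show ?thesis using h Suc by (auto simp: differentiable_def)
qed

lemma smooth_on_differentiable: "smooth_on S f \<Longrightarrow> x \<in> S \<Longrightarrow> f differentiable (at x)"
  unfolding smooth_on_def by (drule spec[of _ "Suc 0"]) simp

lemma smooth_on_continuous: "smooth_on S f \<Longrightarrow> continuous_on S f"
  unfolding smooth_on_def by (drule spec[of _ 0]) simp

lemma smooth_on_dir_deriv:
  "smooth_on S f \<Longrightarrow> smooth_on S (dir_deriv f v)"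
  unfolding smooth_on_def by (metis k_times_differentiable.simps(2))

lemma smooth_on_cong:
  "smooth_on S f \<Longrightarrow> open S \<Longrightarrow> (\<And>x. x \<in> S \<Longrightarrow> f x = g x) \<Longrightarrow> smooth_on S g"
  unfolding smooth_on_def using k_times_differentiable_cong by blast

lemma smooth_on_const: "smooth_on S (\<lambda>_. c)"
  unfolding smooth_on_def using k_times_differentiable_const by blast

lemma smooth_on_add:
  "open S \<Longrightarrow> smooth_on S f \<Longrightarrow> smooth_on S g \<Longrightarrow> smooth_on S (\<lambda>x. f x + g x)"
  unfolding smooth_on_def using k_times_differentiable_add by blast

lemma smooth_on_mult:
  fixes f g :: "'a::euclidean_space \<Rightarrow> 'b::real_normed_algebra"
  shows "open S \<Longrightarrow> smooth_on S f \<Longrightarrow> smooth_on S g \<Longrightarrow> smooth_on S (\<lambda>x. f x * g x)"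
  unfolding smooth_on_def using k_times_differentiable_bilinear[OF bounded_bilinear_mult] by blast

lemma smooth_on_bounded_linear: "bounded_linear f \<Longrightarrow> smooth_on S f"
  unfolding smooth_on_def using k_times_differentiable_bounded_linear by blast

lemma smooth_on_linear_compose:
  "bounded_linear l \<Longrightarrow> open S \<Longrightarrow> smooth_on S f \<Longrightarrow> smooth_on S (\<lambda>x. l (f x))"
  unfolding smooth_on_def using k_times_differentiable_linear_compose by blast

lemma smooth_on_compose:
  "open S \<Longrightarrow> open T \<Longrightarrow> g ` S \<subseteq> T \<Longrightarrow> smooth_on T f \<Longrightarrow> smooth_on S g
    \<Longrightarrow> smooth_on S (\<lambda>x. f (g x))"
  for g :: "'a::euclidean_space \<Rightarrow> 'c::euclidean_space"
  unfolding smooth_on_def using k_times_differentiable_compose by blast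

lemma smooth_on_inverse: "smooth_on {0<..} (inverse :: real \<Rightarrow> real)"
  unfolding smooth_on_def using k_times_differentiable_inverse by blast

lemma smooth_on_ln: "smooth_on {0<..} (ln :: real \<Rightarrow> real)"
  unfolding smooth_on_def using k_times_differentiable_ln by blast

lemma smooth_on_subset:
  assumes "smooth_on S f" "T \<subseteq> S"
  shows "smooth_on T f"
proof -
  have "k_times_differentiable k f S \<Longrightarrow> k_times_differentiable k f T" for k
    by (induction k arbitrary: f) (use assms(2) in \<open>auto intro: continuous_on_subset\<close>)
  then show ?thesis using assms(1) by (simp add: smooth_on_def)
qed

section \<open>Symmetry of second derivatives\<close>

text \<open>The second difference of \<open>f\<close> over a small parallelogram is evaluated by two applications of
  the mean value theorem, first along \<open>u\<close> and then along \<open>v\<close>. It is symmetric in \<open>u\<close> and \<open>v\<close>,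
  which is what forces the two mixed derivatives to agree in the limit.\<close>

lemma second_difference_mvt:
  fixes f :: "'a::euclidean_space \<Rightarrow> real"
  assumes sub: "\<And>a b. \<lbrakk>0 \<le> a; a \<le> s; 0 \<le> b; b \<le> s\<rbrakk> \<Longrightarrow> p + a *\<^sub>R u + b *\<^sub>R v \<in> S"
    and d1: "\<And>x. x \<in> S \<Longrightarrow> f differentiable (at x)"
    and d2: "\<And>x. x \<in> S \<Longrightarrow> (dir_deriv f u) differentiable (at x)"
    and s: "0 < s"
  shows "\<exists>a b. 0 < a \<and> a < s \<and> 0 < b \<and> b < s \<and>
    f (p + s *\<^sub>R u + s *\<^sub>R v) - f (p + s *\<^sub>R u) - f (p + s *\<^sub>R v) + f p =
    s * s * dir_deriv (dir_deriv f u) v (p + a *\<^sub>R u + b *\<^sub>R v)"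
proof -
  have line: "((\<lambda>t. F (q + t *\<^sub>R w + r)) has_real_derivative
      frechet_derivative F (at (q + t *\<^sub>R w + r)) w) (at t)"
    if "F differentiable (at (q + t *\<^sub>R w + r))" for F :: "'a \<Rightarrow> real" and q w r t
  proof -
    have "((\<lambda>t. q + t *\<^sub>R w + r) has_derivative (\<lambda>t. t *\<^sub>R w)) (at t)"
      by (auto intro!: derivative_eq_intros)
    from has_derivative_compose[OF this that[unfolded frechet_derivative_works]]
    have "((\<lambda>t. F (q + t *\<^sub>R w + r)) has_derivative
        (\<lambda>s. frechet_derivative F (at (q + t *\<^sub>R w + r)) (s *\<^sub>R w))) (at t)" .
    then show ?thesis
      by (simp add: has_field_derivative_def linear_cmul[OF linear_frechet_derivative[OF that]]
          mult_commute_abs)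
  qed
  note line0 = line[where r = 0, unfolded add_0_right]
  define P where "P t = f (p + t *\<^sub>R u + s *\<^sub>R v) - f (p + t *\<^sub>R u)" for t
  have "\<exists>a. 0 < a \<and> a < s \<and> P s - P 0 = (s - 0) *
      (frechet_derivative f (at (p + a *\<^sub>R u + s *\<^sub>R v)) u - frechet_derivative f (at (p + a *\<^sub>R u)) u)"
    unfolding P_def
  proof (rule MVT2[OF s])
    fix t assume t: "0 \<le> t" "t \<le> s"
    show "((\<lambda>t. f (p + t *\<^sub>R u + s *\<^sub>R v) - f (p + t *\<^sub>R u)) has_real_derivative
       frechet_derivative f (at (p + t *\<^sub>R u + s *\<^sub>R v)) u - frechet_derivative f (at (p + t *\<^sub>R u)) u) (at t)"
      using sub[of t s] sub[of t 0] t s by (intro DERIV_diff line line0 d1) simp_all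
  qed
  then obtain a where a: "0 < a" "a < s" and Pa: "P s - P 0 = s *
      (frechet_derivative f (at (p + a *\<^sub>R u + s *\<^sub>R v)) u - frechet_derivative f (at (p + a *\<^sub>R u)) u)"
    by auto
  define Q where "Q t = frechet_derivative f (at (p + a *\<^sub>R u + t *\<^sub>R v)) u" for t
  have "\<exists>b. 0 < b \<and> b < s \<and> Q s - Q 0 = (s - 0) *
      dir_deriv (dir_deriv f u) v (p + a *\<^sub>R u + b *\<^sub>R v)"
    unfolding Q_def
    by (rule MVT2[OF s], rule line0, rule d2, rule sub) (use a in simp_all)
  then obtain b where b: "0 < b" "b < s" and Qb: "Q s - Q 0 = s *
      dir_deriv (dir_deriv f u) v (p + a *\<^sub>R u + b *\<^sub>R v)"
    by auto
  have "P s - P 0 = s * (Q s - Q 0)" using Pa by (simp add: Q_def)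
  then have "P s - P 0 = s * s *
      dir_deriv (dir_deriv f u) v (p + a *\<^sub>R u + b *\<^sub>R v)"
    unfolding Qb by simp
  moreover have "P s - P 0 =
      f (p + s *\<^sub>R u + s *\<^sub>R v) - f (p + s *\<^sub>R u) - f (p + s *\<^sub>R v) + f p"
    by (simp add: P_def)
  ultimately show ?thesis using a b by metis
qed

lemma second_derivative_symmetric_real:
  fixes f :: "'a::euclidean_space \<Rightarrow> real"
  assumes "open S" "p \<in> S" "smooth_on S f"
  shows "dir_deriv (dir_deriv f u) v p = dir_deriv (dir_deriv f v) u p"
    (is "?A p = ?B p")
proof (rule ccontr)
  assume ne: "?A p \<noteq> ?B p"
  define e where "e = \<bar>?A p - ?B p\<bar> / 2"
  have e: "e > 0" using ne by (simp add: e_def)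
  have sm: "smooth_on S ?A" "smooth_on S ?B"
    by (rule smooth_on_dir_deriv[OF smooth_on_dir_deriv[OF assms(3)]])+
  have "isCont ?A p" "isCont ?B p"
    using continuous_on_interior[OF smooth_on_continuous[OF sm(1)]]
      continuous_on_interior[OF smooth_on_continuous[OF sm(2)]] assms by (simp_all add: interior_open)
  from this[unfolded continuous_at_eps_delta, rule_format, OF e] obtain d1 d2 where d: "d1 > 0" "d2 > 0"
    and A: "\<And>x. dist x p < d1 \<Longrightarrow> dist (?A x) (?A p) < e"
    and B: "\<And>x. dist x p < d2 \<Longrightarrow> dist (?B x) (?B p) < e"
    unfolding dist_norm by metis
  obtain d3 where d3: "d3 > 0" "ball p d3 \<subseteq> S" using assms open_contains_ball by blast
  define m where "m = min d1 (min d2 d3)"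
  define N where "N = 1 + norm u + norm v"
  have N: "N > 0" and m: "m > 0" using d d3 by (auto simp: N_def m_def add_pos_nonneg)
  \<comment> \<open>The side of the parallelogram, small enough that all of it lies in the ball of radius
    \<open>m\<close>; the summand 1 in \<open>N\<close> keeps the denominator positive.\<close>
  define s where "s = m / (2 * N)"
  have s: "s > 0" using N m by (simp add: s_def)
  have near: "dist (p + a *\<^sub>R u + b *\<^sub>R v) p < m" if "0 \<le> a" "a \<le> s" "0 \<le> b" "b \<le> s" for a b
  proof -
    have "norm (a *\<^sub>R u + b *\<^sub>R v) \<le> a * norm u + b * norm v"
      using norm_triangle_ineq[of "a *\<^sub>R u" "b *\<^sub>R v"] that by simp
    also have "\<dots> \<le> s * norm u + s * norm v" using that by (intro add_mono mult_right_mono) auto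
    also have "\<dots> \<le> s * N" using s by (simp add: N_def algebra_simps)
    also have "\<dots> = m / 2" using N by (simp add: s_def)
    also have "\<dots> < m" using m by simp
    finally show ?thesis by (simp add: dist_norm add.assoc)
  qed
  have in_S: "p + a *\<^sub>R u + b *\<^sub>R v \<in> S" if "0 \<le> a" "a \<le> s" "0 \<le> b" "b \<le> s" for a b
    using near[OF that] d3 by (auto simp: m_def dist_commute subset_iff)
  have in_S': "p + a *\<^sub>R v + b *\<^sub>R u \<in> S" if "0 \<le> a" "a \<le> s" "0 \<le> b" "b \<le> s" for a b
    using in_S[of b a] that by (simp add: algebra_simps)
  note df = smooth_on_differentiable[OF \<open>smooth_on S f\<close>]
    smooth_on_differentiable[OF smooth_on_dir_deriv[OF \<open>smooth_on S f\<close>]]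
  obtain a b where ab: "0 < a" "a < s" "0 < b" "b < s"
    and 1: "f (p + s *\<^sub>R u + s *\<^sub>R v) - f (p + s *\<^sub>R u) - f (p + s *\<^sub>R v) + f p
      = s * s * ?A (p + a *\<^sub>R u + b *\<^sub>R v)"
    using second_difference_mvt[OF in_S df(1,2) s] by blast
  obtain a' b' where ab': "0 < a'" "a' < s" "0 < b'" "b' < s"
    and 2: "f (p + s *\<^sub>R v + s *\<^sub>R u) - f (p + s *\<^sub>R v) - f (p + s *\<^sub>R u) + f p
      = s * s * ?B (p + a' *\<^sub>R v + b' *\<^sub>R u)"
    using second_difference_mvt[OF in_S' df(1,2) s] by blast
  have swap: "p + x *\<^sub>R v + y *\<^sub>R u = p + y *\<^sub>R u + x *\<^sub>R v" for x y by simp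
  have "s * s * ?A (p + a *\<^sub>R u + b *\<^sub>R v) = s * s * ?B (p + b' *\<^sub>R u + a' *\<^sub>R v)"
    using 1 2 unfolding swap by linarith
  then have eq: "?A (p + a *\<^sub>R u + b *\<^sub>R v) = ?B (p + b' *\<^sub>R u + a' *\<^sub>R v)"
    using s by simp
  have "dist (?A (p + a *\<^sub>R u + b *\<^sub>R v)) (?A p) < e" "dist (?B (p + b' *\<^sub>R u + a' *\<^sub>R v)) (?B p) < e"
    using near[of a b] near[of b' a'] ab ab' unfolding m_def by (auto intro!: A B)
  then have "dist (?A p) (?B p) < \<bar>?A p - ?B p\<bar>"
    unfolding e_def eq by (rule dist_triangle_half_r)
  then show False by (simp add: dist_real_def)
qed

text \<open>The mean value theorem holds for real functions only, hence the reduction to the components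
  with respect to a basis.\<close>

lemma second_derivative_symmetric:
  fixes f :: "'a::euclidean_space \<Rightarrow> 'b::euclidean_space"
  assumes "open S" "p \<in> S" "smooth_on S f"
  shows "dir_deriv (dir_deriv f u) v p = dir_deriv (dir_deriv f v) u p"
proof (rule euclidean_eqI)
  fix b :: 'b
  have comm: "frechet_derivative (\<lambda>x. F x \<bullet> b) (at x) w = frechet_derivative F (at x) w \<bullet> b"
    if "F differentiable (at x)" for F :: "'a \<Rightarrow> 'b" and x w
    by (rule frechet_derivative_eqI[OF bounded_linear.has_derivative[OF bounded_linear_inner_left
          that[unfolded frechet_derivative_works]]])
  have sm: "smooth_on S (\<lambda>x. f x \<bullet> b)"
    by (rule smooth_on_linear_compose[OF bounded_linear_inner_left]) fact+
  have *: "dir_deriv (dir_deriv f u) v p \<bullet> b =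
    dir_deriv (dir_deriv (\<lambda>x. f x \<bullet> b) u) v p" for u v
  proof -
    have "dir_deriv (dir_deriv f u) v p \<bullet> b =
      frechet_derivative (\<lambda>x. frechet_derivative f (at x) u \<bullet> b) (at p) v"
      by (rule comm[symmetric]) (rule smooth_on_differentiable[OF
          smooth_on_dir_deriv[OF \<open>smooth_on S f\<close>] \<open>p \<in> S\<close>])
    also have "\<dots> = dir_deriv (dir_deriv (\<lambda>x. f x \<bullet> b) u) v p"
    proof (rule fun_cong[OF frechet_derivative_transform_open[where S=S]])
      show "(\<lambda>x. frechet_derivative f (at x) u \<bullet> b) differentiable (at p)"
        by (rule smooth_on_differentiable[OF smooth_on_linear_compose[OF bounded_linear_inner_left
          \<open>open S\<close> smooth_on_dir_deriv[OF \<open>smooth_on S f\<close>]] \<open>p \<in> S\<close>])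
    qed (use assms comm[OF smooth_on_differentiable[OF \<open>smooth_on S f\<close>]] in auto)
    finally show ?thesis .
  qed
  show "dir_deriv (dir_deriv f u) v p \<bullet> b
      = dir_deriv (dir_deriv f v) u p \<bullet> b"
    unfolding * by (rule second_derivative_symmetric_real) (use assms sm in auto)
qed

section \<open>Wirtinger derivatives\<close>

lemma dir_deriv_linear:
  assumes "f differentiable (at z)"
  shows "dir_deriv f (a + b) z = dir_deriv f a z + dir_deriv f b z"
    and "dir_deriv f (r *\<^sub>R a) z = r *\<^sub>R dir_deriv f a z"
    and "dir_deriv f 0 z = 0"
  using linear_frechet_derivative[OF assms] by (simp_all add: linear_add linear_cmul linear_0)

lemma dir_deriv_mult:
  fixes f g :: "'a::real_normed_vector \<Rightarrow> 'b::real_normed_algebra"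
  assumes "f differentiable (at z)" "g differentiable (at z)"
  shows "dir_deriv (\<lambda>x. f x * g x) a z = f z * dir_deriv g a z + dir_deriv f a z * g z"
  by (rule frechet_derivative_eqI[OF has_derivative_mult])
    (use assms in \<open>simp_all flip: frechet_derivative_works\<close>)

lemma dir_deriv_add:
  assumes "f differentiable (at z)" "g differentiable (at z)"
  shows "dir_deriv (\<lambda>x. f x + g x) a z = dir_deriv f a z + dir_deriv g a z"
  by (rule frechet_derivative_eqI[OF has_derivative_add])
    (use assms in \<open>simp_all flip: frechet_derivative_works\<close>)

lemma dir_deriv_compose:
  assumes "g differentiable (at z)" "f differentiable (at (g z))"
  shows "dir_deriv (\<lambda>x. f (g x)) a z = dir_deriv f (dir_deriv g a z) (g z)"
  by (rule frechet_derivative_eqI[OF has_derivative_compose[where g = f]])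
    (use assms in \<open>simp_all flip: frechet_derivative_works\<close>)

text \<open>A real linear map of the complex plane is the sum of a complex linear and an antilinear map,
  and the Wirtinger derivatives are the two coefficients.\<close>

lemma dir_deriv_Wirtinger:
  assumes "f differentiable (at z)"
  shows "dir_deriv f a z = d_z f z * a + d_zbar f z * cnj a"
proof -
  have "dir_deriv f a z = dir_deriv f (Re a *\<^sub>R 1 + Im a *\<^sub>R \<i>) z"
    by (metis complex_eq mult.commute scaleR_conv_of_real mult.right_neutral)
  also have "\<dots> = Re a *\<^sub>R dir_deriv f 1 z + Im a *\<^sub>R dir_deriv f \<i> z"
    by (simp only: dir_deriv_linear[OF assms])
  also have "\<dots> = d_z f z * a + d_zbar f z * cnj a"
    by (simp add: d_z_def d_zbar_def complex_eq_iff field_simps)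
  finally show ?thesis .
qed

lemma d_z_mult_d_zbar:
  "4 * (d_z f z * d_zbar f z) = (dir_deriv f 1 z)\<^sup>2 + (dir_deriv f \<i> z)\<^sup>2"
  by (simp add: d_z_def d_zbar_def power2_eq_square complex_eq_iff field_simps)

text \<open>The polarization of the preceding identity.\<close>

lemma d_z_d_zbar_polarized:
  "2 * (d_z f z * d_zbar g z + d_zbar f z * d_z g z)
    = dir_deriv f 1 z * dir_deriv g 1 z + dir_deriv f \<i> z * dir_deriv g \<i> z"
  by (simp add: d_z_def d_zbar_def complex_eq_iff field_simps)

lemma smooth_on_dz:
  assumes "open S" "smooth_on S f"
  shows "smooth_on S (d_z f)" "smooth_on S (d_zbar f)"
proof -
  have eq: "d_z f = (\<lambda>z. 1/2 * dir_deriv f 1 z + (-\<i>/2) * dir_deriv f \<i> z)"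
     "d_zbar f = (\<lambda>z. 1/2 * dir_deriv f 1 z + (\<i>/2) * dir_deriv f \<i> z)"
    by (auto simp: d_z_def d_zbar_def fun_eq_iff field_simps)
  show "smooth_on S (d_z f)" "smooth_on S (d_zbar f)"
    unfolding eq
    by (intro smooth_on_add smooth_on_mult smooth_on_const smooth_on_dir_deriv assms)+
qed

text \<open>The two Wirtinger operators compose to a quarter of the Laplacian; the mixed second
  derivatives cancel because they are symmetric.\<close>

lemma d_zbar_d_z:
  assumes "open S" "z \<in> S" "smooth_on S f"
  shows "4 * d_zbar (d_z f) z = dir_deriv (dir_deriv f 1) 1 z + dir_deriv (dir_deriv f \<i>) \<i> z"
proof -
  have d: "dir_deriv f v differentiable (at z)" for v
    by (rule smooth_on_differentiable[OF smooth_on_dir_deriv]) fact+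
  have "d_z f = (\<lambda>z. 1/2 * dir_deriv f 1 z + (-\<i>/2) * dir_deriv f \<i> z)"
    by (auto simp: d_z_def fun_eq_iff field_simps)
  then have dz: "dir_deriv (d_z f) a z
      = 1/2 * dir_deriv (dir_deriv f 1) a z + (-\<i>/2) * dir_deriv (dir_deriv f \<i>) a z" for a
    using d by (simp only: dir_deriv_add dir_deriv_mult differentiable_mult differentiable_const
        frechet_derivative_const mult_zero_left add_0_right)
  have "dir_deriv (dir_deriv f 1) \<i> z = dir_deriv (dir_deriv f \<i>) 1 z"
    by (rule second_derivative_symmetric) fact+
  then show ?thesis
    unfolding d_zbar_def dz by (simp add: algebra_simps)
qed

section \<open>Complex notation for vector fields\<close>

lemma of_complex_to_complex [simp]: "of_complex (to_complex p) = p"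
  by (simp add: of_complex_def to_complex_def vec_eq_iff forall_2)

lemma to_complex_of_complex [simp]: "to_complex (of_complex z) = z"
  by (simp add: of_complex_def to_complex_def)

lemma to_complex_linear [simp]:
  "to_complex (p + q) = to_complex p + to_complex q"
  "to_complex (p - q) = to_complex p - to_complex q"
  "to_complex (r *\<^sub>R p) = of_real r * to_complex p"
  "to_complex 0 = 0"
  by (simp_all add: to_complex_def complex_eq_iff)

lemma to_complex_axis [simp]: "to_complex (axis 1 1) = 1" "to_complex (axis 2 1) = \<i>"
  by (simp_all add: to_complex_def axis_def complex_eq_iff)

lemma bounded_linear_to_complex: "bounded_linear to_complex"
  by (rule linear_conv_bounded_linear[THEN iffD1], rule linearI)
    (simp_all add: scaleR_conv_of_real[symmetric])

lemma bounded_linear_of_complex: "bounded_linear of_complex"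
  by (rule linear_conv_bounded_linear[THEN iffD1], rule linearI)
    (simp_all add: of_complex_def vec_eq_iff forall_2)

lemma to_complex_image: "to_complex ` U = of_complex -` U"
  by force

lemma open_to_complex_image: "open U \<Longrightarrow> open (to_complex ` U)"
  unfolding to_complex_image
  by (rule open_vimage) (auto intro: linear_continuous_on bounded_linear_of_complex)

lemma complex_notation_to_complex [simp]: "complex_notation V (to_complex p) = to_complex (V p)"
  by (simp add: complex_notation_def)

lemma complex_notation_has_derivative:
  assumes "V differentiable (at p)"
  shows "(complex_notation V has_derivative (\<lambda>a. to_complex (frechet_derivative V (at p) (of_complex a))))
    (at (to_complex p))"
proof -
  have "(of_complex has_derivative of_complex) (at (to_complex p))"
    by (rule bounded_linear_imp_has_derivative[OF bounded_linear_of_complex])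
  moreover have "(V has_derivative frechet_derivative V (at p)) (at (of_complex (to_complex p)))"
    using assms by (simp flip: frechet_derivative_works)
  ultimately have "((\<lambda>z. V (of_complex z)) has_derivative
      (\<lambda>a. frechet_derivative V (at p) (of_complex a))) (at (to_complex p))"
    by (rule has_derivative_compose)
  from bounded_linear.has_derivative[OF bounded_linear_to_complex this]
  show ?thesis by (simp add: complex_notation_def comp_def)
qed

lemma dir_deriv_complex_notation:
  assumes "V differentiable (at p)"
  shows "dir_deriv (complex_notation V) (to_complex a) (to_complex p) = to_complex (dir_deriv V a p)"
  using frechet_derivative_eqI[OF complex_notation_has_derivative[OF assms]] by simp

text \<open>All smoothness arguments are carried out on complex functions. This brings the result back
  to vector fields, where it is needed to give the derivatives in the definitions a meaning.\<close>

lemma differentiable_complex_notation_imp: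
  assumes "complex_notation V differentiable (at (to_complex p))"
  shows "V differentiable (at p)"
proof -
  have "(complex_notation V \<circ> to_complex) differentiable (at p)"
    by (rule differentiable_chain_at[OF
          bounded_linear_imp_differentiable[OF bounded_linear_to_complex] assms])
  then have "(of_complex \<circ> (complex_notation V \<circ> to_complex)) differentiable (at p)"
    by (rule differentiable_chain_at[OF _
          bounded_linear_imp_differentiable[OF bounded_linear_of_complex]])
  moreover have "of_complex \<circ> (complex_notation V \<circ> to_complex) = V"
    by (simp add: complex_notation_def fun_eq_iff)
  ultimately show ?thesis by simp
qed

lemma smooth_on_complex_notation:
  assumes "open U" "smooth_on U V"
  shows "smooth_on (to_complex ` U) (complex_notation V)"
proof -
  note W = open_to_complex_image[OF assms(1)]
  have "smooth_on (to_complex ` U) (\<lambda>z. V (of_complex z))"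
    by (rule smooth_on_compose[OF W assms(1) _ assms(2) smooth_on_bounded_linear])
      (auto intro: bounded_linear_of_complex)
  then have "smooth_on (to_complex ` U) (\<lambda>z. to_complex (V (of_complex z)))"
    by (rule smooth_on_linear_compose[OF bounded_linear_to_complex W])
  then show ?thesis by (simp add: complex_notation_def comp_def)
qed

section \<open>Conformal metrics in complex notation\<close>

text \<open>For the metric $\sigma^2 dw d\bar w$ this is the Christoffel symbol $\Gamma^w_{ww}$, the
  only nonzero one besides its conjugate.\<close>

definition conformal_christoffel :: "(complex \<Rightarrow> real) \<Rightarrow> complex \<Rightarrow> complex" where
  "conformal_christoffel \<sigma> w = 2 * d_z (\<lambda>v. complex_of_real (ln (\<sigma> v))) w"

lemma matrix_inv_mat:
  fixes k :: real
  assumes "k \<noteq> 0"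
  shows "matrix_inv (mat k :: real^'n^'n) = mat (1 / k)"
proof -
  have scal: "mat a ** B = a *\<^sub>R B" for a :: real and B :: "real^'n^'n"
    by (simp add: matrix_matrix_mult_def mat_def vec_eq_iff if_distrib[of "\<lambda>x. x * _"] cong: if_cong)
  have mat_scal: "a *\<^sub>R mat b = (mat (a * b) :: real^'n^'n)" for a b :: real
    by (simp add: mat_def vec_eq_iff)
  have "invertible (mat k :: real^'n^'n)"
    unfolding invertible_def using assms
    by (intro exI[of _ "mat (1 / k)"]) (simp add: scal mat_scal)
  then have "mat k ** matrix_inv (mat k :: real^'n^'n) = mat 1"
    unfolding invertible_def matrix_inv_def by (rule someI2_ex) simp
  then have "k *\<^sub>R matrix_inv (mat k :: real^'n^'n) = mat 1" by (simp add: scal)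
  then have "(1 / k) *\<^sub>R (k *\<^sub>R matrix_inv (mat k :: real^'n^'n)) = mat (1 / k)"
    by (simp add: mat_scal)
  then show ?thesis using assms by simp
qed

locale conformal_metric =
  fixes W :: "(real^2) set" and h :: "real^2 \<Rightarrow> real^2^2" and \<sigma> :: "complex \<Rightarrow> real"
  assumes open_W: "open W"
    and smooth: "smooth_on (to_complex ` W) \<sigma>"
    and pos: "p \<in> W \<Longrightarrow> \<sigma> (to_complex p) > 0"
    and metric: "p \<in> W \<Longrightarrow> h p = mat ((\<sigma> (to_complex p))\<^sup>2)"
begin

abbreviation \<Gamma> :: "complex \<Rightarrow> complex" where "\<Gamma> \<equiv> conformal_christoffel \<sigma>"

lemma open_image: "open (to_complex ` W)"
  by (rule open_to_complex_image[OF open_W])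

lemma smooth_ln: "smooth_on (to_complex ` W) (\<lambda>w. complex_of_real (ln (\<sigma> w)))"
proof -
  have "smooth_on (to_complex ` W) (\<lambda>w. ln (\<sigma> w))"
    by (rule smooth_on_compose[OF open_image open_greaterThan _ smooth_on_ln smooth]) (auto simp: pos)
  then show ?thesis by (rule smooth_on_linear_compose[OF bounded_linear_of_real open_image])
qed

lemma smooth_\<Gamma>: "smooth_on (to_complex ` W) \<Gamma>"
  unfolding conformal_christoffel_def
  by (rule smooth_on_mult[OF open_image smooth_on_const smooth_on_dz(1)[OF open_image smooth_ln]])

lemma d_\<Gamma>:
  assumes "w \<in> to_complex ` W"
  shows "d_z \<Gamma> w = 2 * d_z (d_z (\<lambda>v. complex_of_real (ln (\<sigma> v)))) w"
    and "d_zbar \<Gamma> w = 2 * d_zbar (d_z (\<lambda>v. complex_of_real (ln (\<sigma> v)))) w"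
proof -
  let ?l = "d_z (\<lambda>v. complex_of_real (ln (\<sigma> v)))"
  have "?l differentiable (at w)"
    by (rule smooth_on_differentiable[OF smooth_on_dz(1)[OF open_image smooth_ln] assms])
  then have "dir_deriv \<Gamma> a w = 2 * dir_deriv ?l a w" for a
    unfolding conformal_christoffel_def by (subst dir_deriv_mult) simp_all
  then show "d_z \<Gamma> w = 2 * d_z ?l w" "d_zbar \<Gamma> w = 2 * d_zbar ?l w"
    by (simp_all add: d_z_def d_zbar_def field_simps)
qed

lemma \<Gamma>_eq:
  assumes "p \<in> W"
  shows "\<Gamma> (to_complex p) = (of_real (dir_deriv \<sigma> 1 (to_complex p))
      - \<i> * of_real (dir_deriv \<sigma> \<i> (to_complex p))) / of_real (\<sigma> (to_complex p))"
proof -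
  have "\<sigma> differentiable (at (to_complex p))"
    by (rule smooth_on_differentiable[OF smooth]) (use assms in simp)
  then have s: "(\<sigma> has_derivative frechet_derivative \<sigma> (at (to_complex p))) (at (to_complex p))"
    by (simp flip: frechet_derivative_works)
  have "((\<lambda>w. complex_of_real (ln (\<sigma> w))) has_derivative
      (\<lambda>a. of_real (dir_deriv \<sigma> a (to_complex p) * inverse (\<sigma> (to_complex p))))) (at (to_complex p))"
    by (rule bounded_linear.has_derivative[OF bounded_linear_of_real], rule has_derivative_ln[OF pos s])
      (rule assms)
  then have D: "dir_deriv (\<lambda>w. complex_of_real (ln (\<sigma> w))) a (to_complex p)
      = of_real (dir_deriv \<sigma> a (to_complex p)) * inverse (of_real (\<sigma> (to_complex p)))" for a
    by (simp add: frechet_derivative_eqI)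
  have "2 * ((X * inverse s - \<i> * (Y * inverse s)) / 2) = (X - \<i> * Y) / s" for X Y s :: complex
    by (simp only: divide_inverse left_diff_distrib) simp
  then show ?thesis
    unfolding conformal_christoffel_def d_z_def D .
qed

text \<open>These are the components $\delta_{jk} \partial_i \ln\sigma + \delta_{ik} \partial_j \ln\sigma
  - \delta_{ij} \partial_k \ln\sigma$ familiar from conformally flat metrics.\<close>

lemma christoffel_conformal:
  assumes "p \<in> W"
  shows "christoffel h k i j p =
    ((if j = k then dir_deriv \<sigma> (to_complex (axis i 1)) (to_complex p) else 0)
     + (if i = k then dir_deriv \<sigma> (to_complex (axis j 1)) (to_complex p) else 0)
     - (if i = j then dir_deriv \<sigma> (to_complex (axis k 1)) (to_complex p) else 0)) / \<sigma> (to_complex p)"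
proof -
  define s where "s = \<sigma> (to_complex p)"
  have s: "s > 0" unfolding s_def by (rule pos[OF assms])
  define S where "S i = dir_deriv \<sigma> (to_complex (axis i 1)) (to_complex p)" for i :: 2
  have pd_h: "pd i (\<lambda>q. h q $ j $ l) p = (if j = l then 2 * s * S i else 0)" for i j l
  proof -
    have "\<sigma> differentiable (at (to_complex p))"
      by (rule smooth_on_differentiable[OF smooth]) (use assms in simp)
    then have "(\<sigma> has_derivative frechet_derivative \<sigma> (at (to_complex p))) (at (to_complex p))"
      by (simp flip: frechet_derivative_works)
    from has_derivative_compose[OF bounded_linear_imp_has_derivative[OF bounded_linear_to_complex] this]
    have "((\<lambda>q. \<sigma> (to_complex q)) has_derivative (\<lambda>a. dir_deriv \<sigma> (to_complex a) (to_complex p))) (at p)" .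
    from has_derivative_mult[OF this this]
    have d: "((\<lambda>q. (\<sigma> (to_complex q))\<^sup>2) has_derivative
        (\<lambda>a. 2 * s * dir_deriv \<sigma> (to_complex a) (to_complex p))) (at p)"
      by (simp add: power2_eq_square s_def algebra_simps)
    show ?thesis
    proof (cases "j = l")
      case True
      have "((\<lambda>q. h q $ j $ l) has_derivative
          (\<lambda>a. 2 * s * dir_deriv \<sigma> (to_complex a) (to_complex p))) (at p)"
        by (rule has_derivative_transform_within_open[OF d open_W assms])
          (simp add: metric mat_def True)
      then show ?thesis using True by (simp add: pd_def frechet_derivative_eqI S_def)
    next
      case False
      have "((\<lambda>q. h q $ j $ l) has_derivative (\<lambda>a. 0)) (at p)"
        by (rule has_derivative_transform_within_open[OF has_derivative_const open_W assms])
          (simp add: metric mat_def False)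
      then show ?thesis using False by (simp add: pd_def frechet_derivative_eqI)
    qed
  qed
  have inv: "matrix_inv (h p) = mat (1 / s\<^sup>2)"
    using s by (simp add: metric[OF assms] matrix_inv_mat flip: s_def)
  have "christoffel h k i j p = (\<Sum>l\<in>UNIV. (if k = l then 1 / s\<^sup>2 *
      ((if j = l then 2 * s * S i else 0) + (if i = l then 2 * s * S j else 0)
       - (if i = j then 2 * s * S l else 0)) else 0)) / 2"
    unfolding christoffel_def inv pd_h mat_def by (intro arg_cong2[of _ _ _ _ "(/)"] sum.cong) auto
  also have "\<dots> = ((if j = k then S i else 0) + (if i = k then S j else 0)
      - (if i = j then S k else 0)) / s"
    using s by (simp add: power2_eq_square field_simps)
  finally show ?thesis by (simp only: S_def s_def)
qed

text \<open>The Christoffel form of a conformal metric is complex bilinear, hence a mere multiplication.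
  This is the fact that makes complex notation efficient: from here on the connection is handled
  as the single complex function \<open>\<Gamma>\<close>.\<close>

lemma christoffel_form_complex:
  assumes "p \<in> W"
  shows "to_complex (christoffel_form h p a b) = \<Gamma> (to_complex p) * to_complex a * to_complex b"
proof -
  have "(1::2) \<noteq> 2" by simp
  then show ?thesis
    using pos[OF assms]
    by (simp add: christoffel_form_def christoffel_conformal[OF assms] \<Gamma>_eq[OF assms] sum_2
        to_complex_def[of "vec_lambda _"] to_complex_def[of a] to_complex_def[of b]
        complex_eq_iff Re_divide_of_real Im_divide_of_real field_simps)
qed

lemma levi_civita_complex:
  assumes "p \<in> W" "Y differentiable (at p)"
  shows "to_complex (levi_civita h X Y p) =
    dir_deriv (complex_notation Y) (to_complex (X p)) (to_complex p)
    + \<Gamma> (to_complex p) * to_complex (X p) * to_complex (Y p)"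
  by (simp add: levi_civita_def dir_deriv_complex_notation[OF assms(2)]
      christoffel_form_complex[OF assms(1)])

lemma levi_civita_const_complex:
  assumes "p \<in> W"
  shows "to_complex (levi_civita h (\<lambda>_. a) (\<lambda>_. b) p) = \<Gamma> (to_complex p) * to_complex a * to_complex b"
  by (simp add: levi_civita_def christoffel_form_complex[OF assms(1)])

text \<open>Because of this identity the domain metric enters the tension and bitension fields only
  through its inverse and not through its connection: the Christoffel form takes the values
  \<open>\<Gamma>\<close> and \<open>\<i>\<^sup>2 \<Gamma>\<close> on the two coordinate vectors.\<close>

lemma levi_civita_coord_trace:
  assumes "p \<in> W"
  shows "levi_civita h (coord_field 1) (coord_field 1) p + levi_civita h (coord_field 2) (coord_field 2) p = 0"
proof -
  have ii: "x * \<i> * \<i> = - x" for x by (simp add: complex_eq_iff)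
  have "to_complex (levi_civita h (coord_field 1) (coord_field 1) p
      + levi_civita h (coord_field 2) (coord_field 2) p) = 0"
    unfolding coord_field_def to_complex_linear(1) levi_civita_const_complex[OF assms]
      to_complex_axis ii by simp
  then have "of_complex (to_complex (levi_civita h (coord_field 1) (coord_field 1) p
      + levi_civita h (coord_field 2) (coord_field 2) p)) = of_complex (to_complex 0)"
    by (simp only: to_complex_linear(4))
  then show ?thesis by (simp only: of_complex_to_complex)
qed

lemma metric_trace_conformal:
  assumes "p \<in> W"
  shows "to_complex (metric_trace h p b) =
    (to_complex (b 1 1) + to_complex (b 2 2)) / (of_real (\<sigma> (to_complex p)))\<^sup>2"
proof -
  have "matrix_inv (h p) = mat (1 / (\<sigma> (to_complex p))\<^sup>2)"
    using pos[OF assms] by (simp add: metric[OF assms] matrix_inv_mat)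
  then show ?thesis
    by (simp add: metric_trace_def sum_2 mat_def add_divide_distrib)
qed

text \<open>For constant \<open>b\<close> and \<open>c\<close> the field $\nabla_b c$ is \<open>\<Gamma> b c\<close>. Differentiating it
  along \<open>a\<close> gives $\Gamma_w a + \Gamma_{\bar w} \bar a$ as coefficient of \<open>b c\<close>, and the
  quadratic term \<open>\<Gamma>\<^sup>2 a b c\<close>; after antisymmetrization in \<open>a\<close> and \<open>b\<close> only the
  $\Gamma_{\bar w}$ term survives.\<close>

lemma curvature_complex:
  assumes "p \<in> W"
  shows "to_complex (curvature h p a b c) = d_zbar \<Gamma> (to_complex p) *
    (cnj (to_complex a) * to_complex b - to_complex a * cnj (to_complex b)) * to_complex c"
proof -
  let ?w = "to_complex p"
  have \<Gamma>: "\<Gamma> differentiable (at w)" if "w \<in> to_complex ` W" for w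
    by (rule smooth_on_differentiable[OF smooth_\<Gamma> that])
  have w: "?w \<in> to_complex ` W" using assms by simp
  have second: "to_complex (levi_civita h (\<lambda>_. a) (levi_civita h (\<lambda>_. b) (\<lambda>_. c)) p)
      = (d_z \<Gamma> ?w * to_complex a + d_zbar \<Gamma> ?w * cnj (to_complex a)) * to_complex b * to_complex c
        + (\<Gamma> ?w)\<^sup>2 * to_complex a * to_complex b * to_complex c" for a b
  proof -
    let ?Y = "levi_civita h (\<lambda>_. b) (\<lambda>_. c)"
    let ?G = "\<lambda>w. \<Gamma> w * (to_complex b * to_complex c)"
    have eq: "?G w = complex_notation ?Y w" if "w \<in> to_complex ` W" for w
      using that by (auto simp: levi_civita_const_complex)
    have G: "?G differentiable (at ?w)"
      by (rule differentiable_mult[OF \<Gamma>[OF w] differentiable_const])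
    have d: "?Y differentiable (at p)"
      by (rule differentiable_complex_notation_imp, rule differentiable_transform_open[OF G open_image w eq])
    have "dir_deriv (complex_notation ?Y) (to_complex a) ?w = dir_deriv ?G (to_complex a) ?w"
      by (rule fun_cong[OF frechet_derivative_transform_open[OF G open_image w eq], symmetric])
    also have "\<dots> = dir_deriv \<Gamma> (to_complex a) ?w * (to_complex b * to_complex c)"
      by (simp add: dir_deriv_mult[OF \<Gamma>[OF w] differentiable_const])
    also have "\<dots> = (d_z \<Gamma> ?w * to_complex a + d_zbar \<Gamma> ?w * cnj (to_complex a))
        * (to_complex b * to_complex c)"
      by (simp only: dir_deriv_Wirtinger[OF \<Gamma>[OF w]])
    finally show ?thesis
      by (simp add: levi_civita_complex[OF assms d] levi_civita_const_complex[OF assms]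
          power2_eq_square algebra_simps)
  qed
  \<comment> \<open>Constant fields commute.\<close>
  have "levi_civita h (lie_bracket (\<lambda>_. a) (\<lambda>_. b)) (\<lambda>_. c) p = 0"
    by (simp add: levi_civita_def lie_bracket_def christoffel_form_def vec_eq_iff)
  then show ?thesis
    by (simp add: curvature_def curvature_field_def second algebra_simps)
qed

end

section \<open>Tension and bitension of a map between conformal metrics\<close>

locale conformal_map =
  source: conformal_metric U g \<rho> + target: conformal_metric W h \<sigma>
  for U g \<rho> W h \<sigma> +
  fixes f :: "real^2 \<Rightarrow> real^2"
  assumes smooth_f: "smooth_on U f" and f_in: "p \<in> U \<Longrightarrow> f p \<in> W"
begin

abbreviation F :: "complex \<Rightarrow> complex" where "F \<equiv> complex_notation f"
abbreviation \<tau> :: "complex \<Rightarrow> complex" where "\<tau> \<equiv> complex_notation (tension g h f)"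
abbreviation D :: "complex set" where "D \<equiv> to_complex ` U"
abbreviation \<Gamma> :: "complex \<Rightarrow> complex" where "\<Gamma> \<equiv> conformal_christoffel \<sigma>"

lemmas open_D = source.open_image

lemma f_differentiable: "p \<in> U \<Longrightarrow> f differentiable (at p)"
  by (rule smooth_on_differentiable[OF smooth_f])

lemma F_smooth: "smooth_on D F"
  by (rule smooth_on_complex_notation[OF source.open_W smooth_f])

lemma F_image: "F ` D \<subseteq> to_complex ` W"
  using f_in by auto

lemma smooth_\<Gamma>_F: "smooth_on D (\<lambda>z. \<Gamma> (F z))"
  by (rule smooth_on_compose[OF open_D target.open_image F_image target.smooth_\<Gamma> F_smooth])

lemma pullback_connection_complex:
  assumes "p \<in> U" "V differentiable (at p)"
  shows "to_complex (pullback_connection h f X V p) =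
    dir_deriv (complex_notation V) (to_complex (X p)) (to_complex p)
    + \<Gamma> (F (to_complex p)) * dir_deriv F (to_complex (X p)) (to_complex p) * to_complex (V p)"
  by (simp add: pullback_connection_def differential_def dir_deriv_complex_notation[OF assms(2)]
      dir_deriv_complex_notation[OF f_differentiable[OF assms(1)]]
      target.christoffel_form_complex[OF f_in[OF assms(1)]])

text \<open>Covariant differentiation preserves smoothness and is explicit as a function on the whole
  domain, so that it can be iterated.\<close>

lemma pullback_connection_field:
  assumes V: "smooth_on D (complex_notation V)"
  shows "smooth_on D (complex_notation (pullback_connection h f (coord_field i) V))"
    and "z \<in> D \<Longrightarrow> complex_notation (pullback_connection h f (coord_field i) V) z =
      dir_deriv (complex_notation V) (to_complex (axis i 1)) z
      + \<Gamma> (F z) * dir_deriv F (to_complex (axis i 1)) z * complex_notation V z"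
proof -
  have d: "V differentiable (at p)" if "p \<in> U" for p
    by (rule differentiable_complex_notation_imp[OF smooth_on_differentiable[OF V]]) (use that in simp)
  show eq: "complex_notation (pullback_connection h f (coord_field i) V) z =
      dir_deriv (complex_notation V) (to_complex (axis i 1)) z
      + \<Gamma> (F z) * dir_deriv F (to_complex (axis i 1)) z * complex_notation V z" if "z \<in> D" for z
    using that by (auto simp: pullback_connection_complex[OF _ d] coord_field_def)
  show "smooth_on D (complex_notation (pullback_connection h f (coord_field i) V))"
    by (rule smooth_on_cong[OF smooth_on_add[OF open_D smooth_on_dir_deriv[OF V]
          smooth_on_mult[OF open_D smooth_on_mult[OF open_D smooth_\<Gamma>_F
            smooth_on_dir_deriv[OF F_smooth]] V]] open_D eq[symmetric]])
qed

lemma differential_coord_field: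
  assumes "z \<in> D"
  shows "complex_notation (differential f (coord_field i)) z = dir_deriv F (to_complex (axis i 1)) z"
  using assms by (auto simp: differential_def coord_field_def dir_deriv_complex_notation f_differentiable)

lemma smooth_differential_coord_field:
  "smooth_on D (complex_notation (differential f (coord_field i)))"
  by (rule smooth_on_cong[OF smooth_on_dir_deriv[OF F_smooth] open_D
        differential_coord_field[symmetric]])

lemma dir_deriv_differential_coord_field:
  assumes "z \<in> D"
  shows "dir_deriv (complex_notation (differential f (coord_field i))) a z
    = dir_deriv (dir_deriv F (to_complex (axis i 1))) a z"
  by (rule fun_cong[OF frechet_derivative_transform_open[OF smooth_on_differentiable[OF
        smooth_differential_coord_field assms] open_D assms differential_coord_field]])

text \<open>The domain terms of the second fundamental form add up to zero by the trace identity for the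
  Christoffel form. What is left is the Laplacian of the map plus \<open>\<Gamma>\<close> times the sum of the
  squares of its two partial derivatives, and that sum factors into Wirtinger derivatives.\<close>

lemma tension_complex:
  assumes z: "z \<in> D"
  shows "\<tau> z = 4 / (of_real (\<rho> z))\<^sup>2 * (d_zbar (d_z F) z + \<Gamma> (F z) * d_z F z * d_zbar F z)"
proof -
  from z obtain p where p: "p \<in> U" and zp: "z = to_complex p" by blast
  let ?S = "\<lambda>i. second_fundamental_form g h f (coord_field i) (coord_field i) p"
  let ?P = "\<lambda>i. pullback_connection h f (coord_field i) (differential f (coord_field i))"
  have "differential f (levi_civita g (coord_field 1) (coord_field 1)) p
      + differential f (levi_civita g (coord_field 2) (coord_field 2)) p = 0"
    by (simp add: differential_def source.levi_civita_coord_trace[OF p]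
        dir_deriv_linear[OF f_differentiable[OF p]] flip: dir_deriv_linear(1)[OF f_differentiable[OF p]])
  then have "?S 1 + ?S 2 = ?P 1 p + ?P 2 p"
    by (simp add: second_fundamental_form_def algebra_simps)
  then have "to_complex (?S 1) + to_complex (?S 2) = complex_notation (?P 1) z + complex_notation (?P 2) z"
    unfolding zp complex_notation_to_complex by (metis to_complex_linear(1))
  also have "\<dots> = (dir_deriv (dir_deriv F 1) 1 z + dir_deriv (dir_deriv F \<i>) \<i> z)
      + \<Gamma> (F z) * ((dir_deriv F 1 z)\<^sup>2 + (dir_deriv F \<i> z)\<^sup>2)"
    by (simp add: pullback_connection_field(2)[OF smooth_differential_coord_field z]
        differential_coord_field[OF z] dir_deriv_differential_coord_field[OF z]
        power2_eq_square algebra_simps)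
  also have "\<dots> = 4 * (d_zbar (d_z F) z + \<Gamma> (F z) * d_z F z * d_zbar F z)"
    unfolding d_zbar_d_z[OF open_D z F_smooth, symmetric] d_z_mult_d_zbar[symmetric]
    by (simp add: algebra_simps)
  finally show ?thesis
    by (simp add: zp tension_def source.metric_trace_conformal[OF p])
qed

lemma smooth_\<tau>: "smooth_on D \<tau>"
proof -
  have "smooth_on D (\<lambda>z. inverse (\<rho> z))"
    by (rule smooth_on_compose[OF open_D open_greaterThan _ smooth_on_inverse source.smooth])
      (auto simp: source.pos)
  then have r: "smooth_on D (\<lambda>z. complex_of_real (inverse (\<rho> z)))"
    by (rule smooth_on_linear_compose[OF bounded_linear_of_real open_D])
  note dz = smooth_on_dz[OF open_D]
  have "smooth_on D (\<lambda>z. 4 * (complex_of_real (inverse (\<rho> z)) * complex_of_real (inverse (\<rho> z)))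
      * (d_zbar (d_z F) z + \<Gamma> (F z) * d_z F z * d_zbar F z))"
    by (intro smooth_on_mult smooth_on_add open_D smooth_on_const r dz F_smooth smooth_\<Gamma>_F)
  then show ?thesis
    by (rule smooth_on_cong[OF _ open_D])
      (simp add: tension_complex power2_eq_square divide_inverse)
qed

text \<open>Without this fact the derivatives of the tension field in the definition of the bitension
  field would be unspecified.\<close>

lemma tension_differentiable: "p \<in> U \<Longrightarrow> tension g h f differentiable (at p)"
  by (rule differentiable_complex_notation_imp[OF smooth_on_differentiable[OF smooth_\<tau>]]) simp

text \<open>The terms are grouped for the trace: the bracket after the first factor \<open>\<Gamma>\<close> is the
  contribution of the direction \<open>a\<close> to \<open>\<rho>\<^sup>2 \<tau>\<close>, and the last summand comes from the chain rule for \<open>\<Gamma>\<close> along the map.\<close>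

lemma second_covariant_derivative_complex:
  assumes z: "z \<in> D"
  shows "complex_notation (pullback_connection h f (coord_field i)
      (pullback_connection h f (coord_field i) (tension g h f))) z =
    (let a = to_complex (axis i 1); F\<^sub>a = dir_deriv F a z in
      dir_deriv (dir_deriv \<tau> a) a z
      + \<Gamma> (F z) * (dir_deriv (dir_deriv F a) a z + \<Gamma> (F z) * F\<^sub>a\<^sup>2) * \<tau> z
      + 2 * \<Gamma> (F z) * F\<^sub>a * dir_deriv \<tau> a z
      + (d_z \<Gamma> (F z) * F\<^sub>a\<^sup>2 + d_zbar \<Gamma> (F z) * F\<^sub>a * cnj F\<^sub>a) * \<tau> z)"
proof -
  define a where "a = to_complex (axis i 1)"
  let ?V = "pullback_connection h f (coord_field i) (tension g h f)"
  let ?G = "\<lambda>z. \<Gamma> (F z)"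
  note diff = smooth_on_differentiable[OF _ z]
  have G: "?G differentiable (at z)" and Fa: "dir_deriv F a differentiable (at z)"
    and t: "\<tau> differentiable (at z)" and ta: "dir_deriv \<tau> a differentiable (at z)"
    and F: "F differentiable (at z)"
    by (intro diff smooth_\<Gamma>_F F_smooth smooth_\<tau> smooth_on_dir_deriv)+
  have "F z \<in> to_complex ` W" using F_image z by blast
  from smooth_on_differentiable[OF target.smooth_\<Gamma> this]
  have \<Gamma>: "\<Gamma> differentiable (at (F z))" .
  have "dir_deriv (complex_notation ?V) a z
      = dir_deriv (\<lambda>z. dir_deriv \<tau> a z + ?G z * dir_deriv F a z * \<tau> z) a z"
    unfolding a_def
    by (rule fun_cong[OF frechet_derivative_transform_open[OF
          diff[OF pullback_connection_field(1)[OF smooth_\<tau>]] open_D z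
          pullback_connection_field(2)[OF smooth_\<tau>]]])
  also have "\<dots> = dir_deriv (dir_deriv \<tau> a) a z + (?G z * dir_deriv F a z * dir_deriv \<tau> a z
      + (?G z * dir_deriv (dir_deriv F a) a z + dir_deriv ?G a z * dir_deriv F a z) * \<tau> z)"
    by (simp only: dir_deriv_add[OF ta differentiable_mult[OF differentiable_mult[OF G Fa] t]]
        dir_deriv_mult[OF differentiable_mult[OF G Fa] t] dir_deriv_mult[OF G Fa])
  also have "dir_deriv ?G a z = d_z \<Gamma> (F z) * dir_deriv F a z + d_zbar \<Gamma> (F z) * cnj (dir_deriv F a z)"
    unfolding dir_deriv_compose[OF F \<Gamma>] by (rule dir_deriv_Wirtinger[OF \<Gamma>])
  finally have 1: "dir_deriv (complex_notation ?V) a z = dir_deriv (dir_deriv \<tau> a) a z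
      + (?G z * dir_deriv F a z * dir_deriv \<tau> a z + (?G z * dir_deriv (dir_deriv F a) a z
      + (d_z \<Gamma> (F z) * dir_deriv F a z + d_zbar \<Gamma> (F z) * cnj (dir_deriv F a z))
        * dir_deriv F a z) * \<tau> z)" .
  have 2: "complex_notation ?V z = dir_deriv \<tau> a z + ?G z * dir_deriv F a z * \<tau> z"
    unfolding a_def by (rule pullback_connection_field(2)[OF smooth_\<tau> z])
  show ?thesis
    unfolding pullback_connection_field(2)[OF pullback_connection_field(1)[OF smooth_\<tau>] z]
      a_def[symmetric] Let_def 1 2
    by (simp add: power2_eq_square algebra_simps)
qed

text \<open>In the sum over the two coordinate directions the Laplacian of the map and the sum of the
  squares of its derivatives occur in the combination that makes up the tension field, and
  together give \<open>\<rho>\<^sup>2 \<Gamma> \<tau>\<^sup>2\<close>. The terms with $|\phi_x|^2 + |\phi_y|^2$, which are not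
  functions of the product $\phi_z \phi_{\bar z}$, occur both in the rough Laplacian and in the
  curvature and cancel.\<close>

lemma bitension_complex:
  assumes z: "z \<in> D"
  shows "complex_notation (bitension g h f) z = 4 / (of_real (\<rho> z))\<^sup>2 *
    (d_zbar (d_z \<tau>) z
     + \<Gamma> (F z) * (d_z \<tau> z * d_zbar F z + d_zbar \<tau> z * d_z F z + 1/4 * (of_real (\<rho> z))\<^sup>2 * (\<tau> z)\<^sup>2)
     + cnj (\<tau> z) * d_zbar \<Gamma> (F z) * d_z F z * d_zbar F z
     + \<tau> z * d_z F z * d_zbar F z * d_z \<Gamma> (F z))"
proof -
  from z obtain p where p: "p \<in> U" and zp: "z = to_complex p" by blast
  define r where "r = complex_of_real (\<rho> z)"
  have r: "r \<noteq> 0" using source.pos[OF p] by (simp add: r_def zp)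
  let ?t = "tension g h f"
  let ?P = "\<lambda>i. pullback_connection h f (coord_field i) (pullback_connection h f (coord_field i) ?t)"
  let ?Q = "\<lambda>i. pullback_connection h f (levi_civita g (coord_field i) (coord_field i)) ?t p"
  let ?R = "\<lambda>i. curvature h (f p) (differential f (coord_field i) p) (?t p) (differential f (coord_field i) p)"
  define Fx Fy where "Fx = dir_deriv F 1 z" and "Fy = dir_deriv F \<i> z"
  \<comment> \<open>The induced connection is linear in the direction, so the trace of the Christoffel form of
    the domain disappears from it.\<close>
  have Q: "to_complex (?Q 1) + to_complex (?Q 2) = 0"
  proof -
    define a b where "a = to_complex (levi_civita g (coord_field 1) (coord_field 1) p)"
      and "b = to_complex (levi_civita g (coord_field 2) (coord_field 2) p)"
    have ab: "a + b = 0"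
      unfolding a_def b_def to_complex_linear(1)[symmetric] source.levi_civita_coord_trace[OF p] by simp
    note diff = smooth_on_differentiable[OF _ z]
    have "dir_deriv \<tau> a z + dir_deriv \<tau> b z = 0" "dir_deriv F a z + dir_deriv F b z = 0"
      unfolding dir_deriv_linear(1)[OF diff[OF smooth_\<tau>], symmetric]
        dir_deriv_linear(1)[OF diff[OF F_smooth], symmetric] ab
      by (simp_all add: dir_deriv_linear(3)[OF diff] smooth_\<tau> F_smooth)
    moreover have "to_complex (?Q 1) + to_complex (?Q 2) = (dir_deriv \<tau> a z + dir_deriv \<tau> b z)
        + \<Gamma> (F z) * (dir_deriv F a z + dir_deriv F b z) * \<tau> z"
      unfolding pullback_connection_complex[OF p tension_differentiable[OF p]]
      by (simp add: zp a_def b_def algebra_simps)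
    ultimately show ?thesis by simp
  qed
  have P: "to_complex (?P 1 p) + to_complex (?P 2 p) =
      4 * d_zbar (d_z \<tau>) z + \<Gamma> (F z) * (r\<^sup>2 * \<tau> z) * \<tau> z
      + 2 * \<Gamma> (F z) * (2 * (d_z F z * d_zbar \<tau> z + d_zbar F z * d_z \<tau> z))
      + (d_z \<Gamma> (F z) * (4 * (d_z F z * d_zbar F z))
        + d_zbar \<Gamma> (F z) * (Fx * cnj Fx + Fy * cnj Fy)) * \<tau> z"
  proof -
    have tau: "r\<^sup>2 * \<tau> z = 4 * d_zbar (d_z F) z + \<Gamma> (F z) * (4 * (d_z F z * d_zbar F z))"
      unfolding tension_complex[OF z] r_def[symmetric] using r by (simp add: field_simps)
    have "to_complex (?P 1 p) + to_complex (?P 2 p) = complex_notation (?P 1) z + complex_notation (?P 2) z"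
      by (simp add: zp)
    then show ?thesis
      unfolding second_covariant_derivative_complex[OF z] tau d_zbar_d_z[OF open_D z F_smooth]
        d_zbar_d_z[OF open_D z smooth_\<tau>] d_z_mult_d_zbar d_z_d_zbar_polarized
      by (simp add: Fx_def Fy_def Let_def power2_eq_square algebra_simps)
  qed
  have R: "to_complex (?R 1) + to_complex (?R 2) =
      d_zbar \<Gamma> (F z) * ((Fx * cnj Fx + Fy * cnj Fy) * \<tau> z - cnj (\<tau> z) * (4 * (d_z F z * d_zbar F z)))"
  proof -
    have "to_complex (differential f (coord_field i) p) = dir_deriv F (to_complex (axis i 1)) z" for i
      using differential_coord_field[OF z, of i] by (simp add: zp)
    then show ?thesis
      unfolding target.curvature_complex[OF f_in[OF p]] d_z_mult_d_zbar
      by (simp add: zp Fx_def Fy_def power2_eq_square algebra_simps)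
  qed
  have "complex_notation (bitension g h f) z = (to_complex (?P 1 p) + to_complex (?P 2 p)
      - (to_complex (?Q 1) + to_complex (?Q 2)) - (to_complex (?R 1) + to_complex (?R 2))) / r\<^sup>2"
    by (simp add: zp bitension_def source.metric_trace_conformal[OF p] r_def
        diff_divide_distrib add_divide_distrib)
  also have "\<dots> = 4 / r\<^sup>2 *
    (d_zbar (d_z \<tau>) z
     + \<Gamma> (F z) * (d_z \<tau> z * d_zbar F z + d_zbar \<tau> z * d_z F z + 1/4 * r\<^sup>2 * (\<tau> z)\<^sup>2)
     + cnj (\<tau> z) * d_zbar \<Gamma> (F z) * d_z F z * d_zbar F z
     + \<tau> z * d_z F z * d_zbar F z * d_z \<Gamma> (F z))"
    unfolding P Q R times_divide_eq_left
    by (rule arg_cong2[where f = "(/)"]) (simp_all add: power2_eq_square algebra_simps)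
  finally show ?thesis unfolding r_def .
qed

lemma tension_ln_conformal:
  assumes "z \<in> D"
  defines "ln_\<sigma> \<equiv> \<lambda>w. complex_of_real (ln (\<sigma> w))"
  shows "\<tau> z = 4 / (of_real (\<rho> z))\<^sup>2 * (d_zbar (d_z F) z + 2 * d_z ln_\<sigma> (F z) * d_z F z * d_zbar F z)"
  unfolding tension_complex[OF assms(1)] conformal_christoffel_def ln_\<sigma>_def ..

lemma bitension_ln_conformal:
  assumes z: "z \<in> D"
  defines "ln_\<sigma> \<equiv> \<lambda>w. complex_of_real (ln (\<sigma> w))"
  shows "complex_notation (bitension g h f) z = 4 / (of_real (\<rho> z))\<^sup>2 *
    (d_zbar (d_z \<tau>) z
     + 2 * d_z ln_\<sigma> (F z) *
         (d_z \<tau> z * d_zbar F z + d_zbar \<tau> z * d_z F z + 1 / 4 * (of_real (\<rho> z))\<^sup>2 * (\<tau> z)\<^sup>2)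
     + 2 * cnj (\<tau> z) * d_zbar (d_z ln_\<sigma>) (F z) * d_z F z * d_zbar F z
     + 2 * \<tau> z * d_z F z * d_zbar F z * d_z (d_z ln_\<sigma>) (F z))"
proof -
  have w: "F z \<in> to_complex ` W" by (rule subsetD[OF F_image imageI[OF z]])
  have \<Gamma>: "\<Gamma> (F z) = 2 * d_z ln_\<sigma> (F z)"
    unfolding conformal_christoffel_def ln_\<sigma>_def ..
  show ?thesis
    by (rule trans[OF bitension_complex[OF z, unfolded target.d_\<Gamma>[OF w] \<Gamma>]])
      (simp only: ln_\<sigma>_def mult_ac)
qed

end

section \<open>Charts\<close>

lemma open_chart_image:
  fixes c :: "('a::{t2_space, second_countable_topology}, 'n::finite) chart"
  assumes "smooth_atlas A" "c \<in> A" "openin (top_of_set (fst c)) S"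
  shows "open (snd c ` S)"
proof -
  have hom: "homeomorphism (fst c) (snd c ` fst c) (snd c) (chart_inv c)" and "open (snd c ` fst c)"
    using assms(1,2) by (auto simp: smooth_atlas_def)
  then show ?thesis
    using homeomorphism_imp_open_map[OF hom assms(3)] openin_open_trans by blast
qed

lemma isothermal_conformal_metric:
  assumes "isothermal g c \<rho>" "U \<subseteq> snd c ` fst c" "open U"
  shows "conformal_metric U (g c) \<rho>"
proof
  show "smooth_on (to_complex ` U) \<rho>"
    by (rule smooth_on_subset[of "to_complex ` snd c ` fst c"])
      (use assms in \<open>auto simp: isothermal_def\<close>)
qed (use assms in \<open>auto simp: isothermal_def\<close>)

text \<open>The chart domain is cut down to the points that are mapped into the target chart. This set
  has an open image because the map is continuous and charts are homeomorphisms onto open sets;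
  openness is what makes all derivatives in it well behaved.\<close>

lemma conformal_map_local_rep:
  fixes A :: "('a::{t2_space, second_countable_topology}, 2) chart set"
    and B :: "('b::{t2_space, second_countable_topology}, 2) chart set"
  assumes A: "smooth_atlas A" and B: "smooth_atlas B" and \<phi>: "smooth_map A B \<phi>"
    and c: "c \<in> A" and d: "d \<in> B" and g: "isothermal g c \<rho>" and h: "isothermal h d \<sigma>"
  shows "conformal_map (snd c ` (fst c \<inter> \<phi> -` fst d)) (g c) \<rho> (snd d ` fst d) (h d) \<sigma>
    (local_rep c d \<phi>)"
proof -
  have hom: "homeomorphism (fst c) (snd c ` fst c) (snd c) (chart_inv c)"
    using A c by (auto simp: smooth_atlas_def)
  have "open (fst d)" "open (snd d ` fst d)" using B d by (auto simp: smooth_atlas_def)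
  have "continuous_on (fst c) \<phi>"
    using \<phi> c by (auto simp: smooth_map_def carrier_of_def intro: continuous_on_subset)
  then have "openin (top_of_set (fst c)) (fst c \<inter> \<phi> -` fst d)"
    using \<open>open (fst d)\<close> by (rule continuous_openin_preimage_gen)
  then have U: "open (snd c ` (fst c \<inter> \<phi> -` fst d))" by (rule open_chart_image[OF A c])
  interpret source: conformal_metric "snd c ` (fst c \<inter> \<phi> -` fst d)" "g c" \<rho>
    using g U by (intro isothermal_conformal_metric) auto
  interpret target: conformal_metric "snd d ` fst d" "h d" \<sigma>
    using h \<open>open (snd d ` fst d)\<close> by (intro isothermal_conformal_metric) auto
  show ?thesis
  proof
    show "smooth_on (snd c ` (fst c \<inter> \<phi> -` fst d)) (local_rep c d \<phi>)"
      using \<phi> c d by (auto simp: smooth_map_def)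
    show "local_rep c d \<phi> p \<in> snd d ` fst d" if "p \<in> snd c ` (fst c \<inter> \<phi> -` fst d)" for p
      using that by (auto simp: local_rep_def homeomorphism_apply1[OF hom])
  qed
qed

section \<open>The bitension field of a map between surfaces\<close>

theorem theorem2p1:
  fixes A :: "('a::{t2_space, second_countable_topology}, 2) chart set"
    and B :: "('b::{t2_space, second_countable_topology}, 2) chart set"
    and g :: "('a, 2) chart \<Rightarrow> real^2 \<Rightarrow> real^2^2"
    and h :: "('b, 2) chart \<Rightarrow> real^2 \<Rightarrow> real^2^2"
    and \<phi> :: "'a \<Rightarrow> 'b"
    and c :: "('a, 2) chart" and d :: "('b, 2) chart"
    and \<rho> \<sigma> :: "complex \<Rightarrow> real"
  assumes "riemannian_manifold A g" and "riemannian_manifold B h"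
    and "smooth_map A B \<phi>"
    and "c \<in> A" and "d \<in> B"
    and "isothermal g c \<rho>" and "isothermal h d \<sigma>"
  shows "\<forall>z \<in> to_complex ` snd c ` (fst c \<inter> \<phi> -` fst d).
    let f = complex_notation (local_rep c d \<phi>);
        \<tau> = complex_notation (tension_field g h \<phi> c d);
        \<tau>2 = complex_notation (bitension_field g h \<phi> c d);
        r = complex_of_real (\<rho> z);
        ln_\<sigma> = (\<lambda>w. complex_of_real (ln (\<sigma> w)))
    in \<tau> z = 4 / r\<^sup>2 * (d_zbar (d_z f) z + 2 * d_z ln_\<sigma> (f z) * d_z f z * d_zbar f z)
     \<and> \<tau>2 z = 4 / r\<^sup>2 *
         (d_zbar (d_z \<tau>) z
          + 2 * d_z ln_\<sigma> (f z) *
              (d_z \<tau> z * d_zbar f z + d_zbar \<tau> z * d_z f z + 1 / 4 * r\<^sup>2 * (\<tau> z)\<^sup>2)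
          + 2 * cnj (\<tau> z) * d_zbar (d_z ln_\<sigma>) (f z) * d_z f z * d_zbar f z
          + 2 * \<tau> z * d_z f z * d_zbar f z * d_z (d_z ln_\<sigma>) (f z))"
proof -
  have "smooth_atlas A" "smooth_atlas B"
    using assms(1,2) by (simp_all add: riemannian_manifold_def)
  note map = conformal_map_local_rep[OF this assms(3-7)]
  show ?thesis
    unfolding Let_def tension_field_def bitension_field_def
    by (intro ballI conjI conformal_map.tension_ln_conformal[OF map]
        conformal_map.bitension_ln_conformal[OF map])
qed

end
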